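(* Let $T$ be a complete countable NIP theory with monster model $\mathcal U$. Suppose $A\subseteq\mathcal U$ is a (small) set of parameters and $x$ is a countable tuple of variables. Then compressible types are dense in $S^x(A)$: if $\theta(x)$ is a consistent formula over $A$, then there exists a compressible type $p(x)\in S(A)$ with $p(x)\vdash\theta(x)$. More generally, if $\pi(x)$ is a partial type over $A$ which is t-compressible with respect to $A$, then there exists a strongly compressible $p(x)\in S(A)$ with $\pi\subseteq p$.
   Context: $T$ is a complete theory in a language $\mathcal L$, $\mathcal U$ a large saturated model (possibly multi-sorted); small means of cardinality $<|\mathcal U|$. $T$ is NIP if for every formula $\phi(x,y)$ the family $\{\phi(\mathcal U^x,b):b\in\mathcal U^y\}$ has finite VC-dimension. A partial type over $A$ is a consistent set of $\mathcal L(A)$-formulas; $S^x(A)$ is the space of complete types over $A$ in variables $x$; $\vdash$ is implication in $\mathcal U$. Formulas written $\phi(x,y),\zeta(x,z)$ are $\mathcal L$-formulas without parameters. For a set $\Delta$ of partitioned formulas $\phi(x,y)$ and $p\in S^x(A)$, $p\restriction\Delta$ is the set of all formulas $\phi(x,a)$, $\neg\phi(x,a)$ in $p$ with $\phi(x,y)\in\Delta$ and $a$ a tuple from $A$; $p\restriction\phi=p\restriction\{\phi\}$. For a partial type $\pi$ over $A$ and $A_0\subseteq A$, $\pi|_{A_0}$ denotes the part of $\pi$ with parameters from $A_0$ (for $\pi=p\restriction\phi$, it is the set of formulas $\phi(x,a)$, $\neg\phi(x,a)$ in $p$ with $a\in A_0^y$). Let $\pi(x)\subseteq\pi'(x)$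 be partial types over $A$. A formula $\zeta(x,z)$ compresses $\pi$ within $\pi'$ with respect to $A$ if for every finite $A_0\subseteq A$ there is $a\in A^z$ such that $\pi'(x)\vdash\zeta(x,a)$ and $\zeta(x,a)\vdash\pi|_{A_0}(x)$. $\pi$ is compressible within $\pi'$ with respect to $A$ if some formula $\zeta(x,z)$ compresses it within $\pi'$ with respect to $A$. $\pi$ is t-compressible with respect to $A$ if it is compressible within $\pi$ itself with respect to $A$. A type $p(x)\in S(A)$ is compressible if for each formula $\phi(x,y)$, $p\restriction\phi$ is compressible within $p$ with respect to $A$. It is strongly compressible if for each formula $\phi$ there is a finite set of formulas $\Delta\ni\phi$ such that $p\restriction\Delta$ is t-compressible with respect to $A$. *)

theory Defs
  imports "HOL-Library.FuncSet" "HOL-Library.Countable_Set" "HOL-Library.Equipollence"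
begin

section \<open>Many-sorted first-order languages, formulas with parameters, structures\<close>

text \<open>The variable \<open>(n, s)\<close> is the \<open>n\<close>-th variable of sort \<open>s\<close>. A (possibly infinite) tuple of
  distinct variables is represented by the set of its entries.\<close>

type_synonym 's var = "nat \<times> 's"

record ('s, 'f, 'r) lang =
  sorts :: "'s set"
  funs :: "'f set"
  rels :: "'r set"
  fun_dom :: "'f \<Rightarrow> 's list"
  fun_cod :: "'f \<Rightarrow> 's"
  rel_dom :: "'r \<Rightarrow> 's list"

definition wf_lang :: "('s, 'f, 'r) lang \<Rightarrow> bool" where
  "wf_lang L \<longleftrightarrow>
     (\<forall>f\<in>funs L. set (fun_dom L f) \<subseteq> sorts L \<and> fun_cod L f \<in> sorts L) \<and>
     (\<forall>r\<in>rels L. set (rel_dom L r) \<subseteq> sorts L)"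

definition countable_lang :: "('s, 'f, 'r) lang \<Rightarrow> bool" where
  "countable_lang L \<longleftrightarrow> countable (sorts L) \<and> countable (funs L) \<and> countable (rels L)"

text \<open>\<open>Par (s, a)\<close> is the constant naming the element \<open>a\<close> of sort \<open>s\<close>. The elements of a structure
  are always handled as such pairs, so the carriers of different sorts need not be disjoint.\<close>

datatype ('s, 'f, 'u) trm =
    Var "'s var"
  | Par "'s \<times> 'u"
  | App 'f "('s, 'f, 'u) trm list"

datatype ('s, 'f, 'r, 'u) fm =
    Fls
  | Eq "('s, 'f, 'u) trm" "('s, 'f, 'u) trm"
  | Rel 'r "('s, 'f, 'u) trm list"
  | Neg "('s, 'f, 'r, 'u) fm"
  | Conj "('s, 'f, 'r, 'u) fm" "('s, 'f, 'r, 'u) fm"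
  | Exi "'s var" "('s, 'f, 'r, 'u) fm"

fun trm_sort :: "('s, 'f, 'r) lang \<Rightarrow> ('s, 'f, 'u) trm \<Rightarrow> 's" where
  "trm_sort L (Var v) = snd v"
| "trm_sort L (Par c) = fst c"
| "trm_sort L (App f ts) = fun_cod L f"

fun wf_trm :: "('s, 'f, 'r) lang \<Rightarrow> ('s, 'f, 'u) trm \<Rightarrow> bool" where
  "wf_trm L (Var v) \<longleftrightarrow> snd v \<in> sorts L"
| "wf_trm L (Par c) \<longleftrightarrow> fst c \<in> sorts L"
| "wf_trm L (App f ts) \<longleftrightarrow>
     f \<in> funs L \<and> (\<forall>t\<in>set ts. wf_trm L t) \<and> map (trm_sort L) ts = fun_dom L f"

fun wf_fm :: "('s, 'f, 'r) lang \<Rightarrow> ('s, 'f, 'r, 'u) fm \<Rightarrow> bool" where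
  "wf_fm L Fls \<longleftrightarrow> True"
| "wf_fm L (Eq t u) \<longleftrightarrow> wf_trm L t \<and> wf_trm L u \<and> trm_sort L t = trm_sort L u"
| "wf_fm L (Rel r ts) \<longleftrightarrow>
     r \<in> rels L \<and> (\<forall>t\<in>set ts. wf_trm L t) \<and> map (trm_sort L) ts = rel_dom L r"
| "wf_fm L (Neg \<phi>) \<longleftrightarrow> wf_fm L \<phi>"
| "wf_fm L (Conj \<phi> \<psi>) \<longleftrightarrow> wf_fm L \<phi> \<and> wf_fm L \<psi>"
| "wf_fm L (Exi v \<phi>) \<longleftrightarrow> snd v \<in> sorts L \<and> wf_fm L \<phi>"

fun fv_trm :: "('s, 'f, 'u) trm \<Rightarrow> 's var set" where
  "fv_trm (Var v) = {v}"
| "fv_trm (Par c) = {}"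
| "fv_trm (App f ts) = (\<Union>t\<in>set ts. fv_trm t)"

fun fv :: "('s, 'f, 'r, 'u) fm \<Rightarrow> 's var set" where
  "fv Fls = {}"
| "fv (Eq t u) = fv_trm t \<union> fv_trm u"
| "fv (Rel r ts) = (\<Union>t\<in>set ts. fv_trm t)"
| "fv (Neg \<phi>) = fv \<phi>"
| "fv (Conj \<phi> \<psi>) = fv \<phi> \<union> fv \<psi>"
| "fv (Exi v \<phi>) = fv \<phi> - {v}"

fun params_trm :: "('s, 'f, 'u) trm \<Rightarrow> ('s \<times> 'u) set" where
  "params_trm (Var v) = {}"
| "params_trm (Par c) = {c}"
| "params_trm (App f ts) = (\<Union>t\<in>set ts. params_trm t)"

fun params :: "('s, 'f, 'r, 'u) fm \<Rightarrow> ('s \<times> 'u) set" where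
  "params Fls = {}"
| "params (Eq t u) = params_trm t \<union> params_trm u"
| "params (Rel r ts) = (\<Union>t\<in>set ts. params_trm t)"
| "params (Neg \<phi>) = params \<phi>"
| "params (Conj \<phi> \<psi>) = params \<phi> \<union> params \<psi>"
| "params (Exi v \<phi>) = params \<phi>"

text \<open>\<open>inst Y b \<phi>\<close> is \<open>\<phi>(x, b)\<close>: every free occurrence of a variable \<open>v\<close> from \<open>Y\<close> is replaced by
  the constant naming \<open>b v\<close>.\<close>

fun inst_trm :: "'s var set \<Rightarrow> ('s var \<Rightarrow> 'u) \<Rightarrow> ('s, 'f, 'u) trm \<Rightarrow> ('s, 'f, 'u) trm" where
  "inst_trm Y b (Var v) = (if v \<in> Y then Par (snd v, b v) else Var v)"
| "inst_trm Y b (Par c) = Par c"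
| "inst_trm Y b (App f ts) = App f (map (inst_trm Y b) ts)"

fun inst :: "'s var set \<Rightarrow> ('s var \<Rightarrow> 'u) \<Rightarrow> ('s, 'f, 'r, 'u) fm \<Rightarrow> ('s, 'f, 'r, 'u) fm" where
  "inst Y b Fls = Fls"
| "inst Y b (Eq t u) = Eq (inst_trm Y b t) (inst_trm Y b u)"
| "inst Y b (Rel r ts) = Rel r (map (inst_trm Y b) ts)"
| "inst Y b (Neg \<phi>) = Neg (inst Y b \<phi>)"
| "inst Y b (Conj \<phi> \<psi>) = Conj (inst Y b \<phi>) (inst Y b \<psi>)"
| "inst Y b (Exi v \<phi>) = Exi v (inst (Y - {v}) b \<phi>)"

text \<open>\<open>L\<close>-formulas, without parameters.\<close>

definition lfm :: "('s, 'f, 'r) lang \<Rightarrow> ('s, 'f, 'r, 'u) fm \<Rightarrow> bool" where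
  "lfm L \<phi> \<longleftrightarrow> wf_fm L \<phi> \<and> params \<phi> = {}"

text \<open>The \<open>L(A)\<close>-formulas in the variables \<open>X\<close>.\<close>

definition fms :: "('s, 'f, 'r) lang \<Rightarrow> ('s \<times> 'u) set \<Rightarrow> 's var set \<Rightarrow> ('s, 'f, 'r, 'u) fm set" where
  "fms L A X = {\<phi>. wf_fm L \<phi> \<and> params \<phi> \<subseteq> A \<and> fv \<phi> \<subseteq> X}"

record ('s, 'f, 'r, 'u) fo_struct =
  carr :: "'s \<Rightarrow> 'u set"
  fint :: "'f \<Rightarrow> 'u list \<Rightarrow> 'u"
  rint :: "'r \<Rightarrow> 'u list \<Rightarrow> bool"

definition is_struct :: "('s, 'f, 'r) lang \<Rightarrow> ('s, 'f, 'r, 'u) fo_struct \<Rightarrow> bool" where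
  "is_struct L M \<longleftrightarrow>
     (\<forall>s\<in>sorts L. carr M s \<noteq> {}) \<and>
     (\<forall>f\<in>funs L. \<forall>as. list_all2 (\<lambda>a s. a \<in> carr M s) as (fun_dom L f) \<longrightarrow>
        fint M f as \<in> carr M (fun_cod L f))"

definition universe :: "('s, 'f, 'r) lang \<Rightarrow> ('s, 'f, 'r, 'u) fo_struct \<Rightarrow> ('s \<times> 'u) set" where
  "universe L M = Sigma (sorts L) (carr M)"

fun eval :: "('s, 'f, 'r, 'u) fo_struct \<Rightarrow> ('s var \<Rightarrow> 'u) \<Rightarrow> ('s, 'f, 'u) trm \<Rightarrow> 'u" where
  "eval M e (Var v) = e v"
| "eval M e (Par c) = snd c"
| "eval M e (App f ts) = fint M f (map (eval M e) ts)"

fun sat :: "('s, 'f, 'r, 'u) fo_struct \<Rightarrow> ('s var \<Rightarrow> 'u) \<Rightarrow> ('s, 'f, 'r, 'u) fm \<Rightarrow> bool" where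
  "sat M e Fls \<longleftrightarrow> False"
| "sat M e (Eq t u) \<longleftrightarrow> eval M e t = eval M e u"
| "sat M e (Rel r ts) \<longleftrightarrow> rint M r (map (eval M e) ts)"
| "sat M e (Neg \<phi>) \<longleftrightarrow> \<not> sat M e \<phi>"
| "sat M e (Conj \<phi> \<psi>) \<longleftrightarrow> sat M e \<phi> \<and> sat M e \<psi>"
| "sat M e (Exi v \<phi>) \<longleftrightarrow> (\<exists>a\<in>carr M (snd v). sat M (e(v := a)) \<phi>)"

text \<open>\<open>tup A V\<close> is \<open>A\<^sup>V\<close>, the set of tuples from \<open>A\<close> of the sorts of the variables \<open>V\<close>;
  in particular \<open>tup (universe L M) V\<close> is \<open>M\<^sup>V\<close>.\<close>

definition tup :: "('s \<times> 'u) set \<Rightarrow> 's var set \<Rightarrow> ('s var \<Rightarrow> 'u) set" where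
  "tup A V = (\<Pi>\<^sub>E v\<in>V. {a. (snd v, a) \<in> A})"


section \<open>Complete theories, types, saturated models\<close>

definition is_theory :: "('s, 'f, 'r) lang \<Rightarrow> ('s, 'f, 'r, 'u) fm set \<Rightarrow> bool" where
  "is_theory L T \<longleftrightarrow> (\<forall>\<sigma>\<in>T. lfm L \<sigma> \<and> fv \<sigma> = {})"

definition models ::
    "('s, 'f, 'r) lang \<Rightarrow> ('s, 'f, 'r, 'u) fo_struct \<Rightarrow> ('s, 'f, 'r, 'u) fm set \<Rightarrow> bool" where
  "models L M T \<longleftrightarrow> is_struct L M \<and> (\<forall>\<sigma>\<in>T. sat M (\<lambda>_. undefined) \<sigma>)"

text \<open>The quantifier ranges over the models of \<open>T\<close> inside the type \<open>'u\<close>. For a countable language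
  and infinite \<open>'u\<close> this is the usual consequence relation, by downward Loewenheim-Skolem.\<close>

definition entails ::
    "('s, 'f, 'r) lang \<Rightarrow> ('s, 'f, 'r, 'u) fm set \<Rightarrow> ('s, 'f, 'r, 'u) fm \<Rightarrow> bool" where
  "entails L T \<sigma> \<longleftrightarrow> (\<forall>M :: ('s, 'f, 'r, 'u) fo_struct. models L M T \<longrightarrow> models L M {\<sigma>})"

definition complete_theory :: "('s, 'f, 'r) lang \<Rightarrow> ('s, 'f, 'r, 'u) fm set \<Rightarrow> bool" where
  "complete_theory L T \<longleftrightarrow>
     is_theory L T \<and> (\<exists>M :: ('s, 'f, 'r, 'u) fo_struct. models L M T) \<and>
     (\<forall>\<sigma>. lfm L \<sigma> \<and> fv \<sigma> = {} \<longrightarrow> entails L T \<sigma> \<or> entails L T (Neg \<sigma>))"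

definition realizes ::
    "('s, 'f, 'r, 'u) fo_struct \<Rightarrow> ('s var \<Rightarrow> 'u) \<Rightarrow> ('s, 'f, 'r, 'u) fm set \<Rightarrow> bool" where
  "realizes M e \<Gamma> \<longleftrightarrow> (\<forall>\<phi>\<in>\<Gamma>. sat M e \<phi>)"

definition consistent ::
    "('s, 'f, 'r) lang \<Rightarrow> ('s, 'f, 'r, 'u) fo_struct \<Rightarrow> 's var set \<Rightarrow> ('s, 'f, 'r, 'u) fm set \<Rightarrow> bool" where
  "consistent L M X \<Gamma> \<longleftrightarrow>
     (\<forall>\<Gamma>\<^sub>0 \<subseteq> \<Gamma>. finite \<Gamma>\<^sub>0 \<longrightarrow> (\<exists>e\<in>tup (universe L M) X. realizes M e \<Gamma>\<^sub>0))"

definition partial_type ::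
    "('s, 'f, 'r) lang \<Rightarrow> ('s, 'f, 'r, 'u) fo_struct \<Rightarrow> ('s \<times> 'u) set \<Rightarrow> 's var set \<Rightarrow>
     ('s, 'f, 'r, 'u) fm set \<Rightarrow> bool" where
  "partial_type L M A X \<pi> \<longleftrightarrow> \<pi> \<subseteq> fms L A X \<and> consistent L M X \<pi>"

definition type_space ::
    "('s, 'f, 'r) lang \<Rightarrow> ('s, 'f, 'r, 'u) fo_struct \<Rightarrow> ('s \<times> 'u) set \<Rightarrow> 's var set \<Rightarrow>
     ('s, 'f, 'r, 'u) fm set set" where
  "type_space L M A X =
     {p. partial_type L M A X p \<and> (\<forall>\<phi>\<in>fms L A X. \<phi> \<in> p \<or> Neg \<phi> \<in> p)}"

definition saturated :: "('s, 'f, 'r) lang \<Rightarrow> ('s, 'f, 'r, 'u) fo_struct \<Rightarrow> bool" where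
  "saturated L M \<longleftrightarrow>
     (\<forall>B v \<pi>. B \<subseteq> universe L M \<and> B \<prec> universe L M \<and> snd v \<in> sorts L \<and> partial_type L M B {v} \<pi> \<longrightarrow>
        (\<exists>e\<in>tup (universe L M) {v}. realizes M e \<pi>))"

text \<open>``Large'' is read as uncountable, i.e. larger than the (countable) language.\<close>

definition monster_model ::
    "('s, 'f, 'r) lang \<Rightarrow> ('s, 'f, 'r, 'u) fm set \<Rightarrow> ('s, 'f, 'r, 'u) fo_struct \<Rightarrow> bool" where
  "monster_model L T U \<longleftrightarrow> models L U T \<and> saturated L U \<and> uncountable (universe L U)"

definition implies_in ::
    "('s, 'f, 'r) lang \<Rightarrow> ('s, 'f, 'r, 'u) fo_struct \<Rightarrow> 's var set \<Rightarrow>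
     ('s, 'f, 'r, 'u) fm set \<Rightarrow> ('s, 'f, 'r, 'u) fm set \<Rightarrow> bool" where
  "implies_in L U X \<Gamma> \<Psi> \<longleftrightarrow> (\<forall>e\<in>tup (universe L U) X. realizes U e \<Gamma> \<longrightarrow> realizes U e \<Psi>)"


section \<open>NIP\<close>

definition shatters :: "'a set set \<Rightarrow> 'a set \<Rightarrow> bool" where
  "shatters F S \<longleftrightarrow> (\<forall>B\<subseteq>S. \<exists>C\<in>F. C \<inter> S = B)"

definition finite_vc_dim :: "'a set set \<Rightarrow> bool" where
  "finite_vc_dim F \<longleftrightarrow> (\<exists>n. \<forall>S. finite S \<and> shatters F S \<longrightarrow> card S \<le> n)"

text \<open>NIP of a complete theory, expressed in its monster model \<open>U\<close>.\<close>

definition NIP :: "('s, 'f, 'r) lang \<Rightarrow> ('s, 'f, 'r, 'u) fo_struct \<Rightarrow> bool" where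
  "NIP L U \<longleftrightarrow>
     (\<forall>(\<phi> :: ('s, 'f, 'r, 'u) fm) X Y.
        lfm L \<phi> \<and> finite X \<and> finite Y \<and> X \<union> Y \<subseteq> UNIV \<times> sorts L \<and> X \<inter> Y = {} \<and> fv \<phi> \<subseteq> X \<union> Y \<longrightarrow>
        finite_vc_dim
          ((\<lambda>b. {a \<in> tup (universe L U) X. sat U a (inst Y b \<phi>)}) ` tup (universe L U) Y))"


section \<open>Compressibility\<close>

text \<open>The tuple \<open>x\<close>. Any countable tuple of variables can be renamed so that, as required here,
  infinitely many variables of each sort remain available for \<open>y\<close> and \<open>z\<close> in \<open>\<phi>(x, y)\<close> and
  \<open>\<zeta>(x, z)\<close>.\<close>

definition var_tuple :: "('s, 'f, 'r) lang \<Rightarrow> 's var set \<Rightarrow> bool" where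
  "var_tuple L X \<longleftrightarrow>
     X \<subseteq> UNIV \<times> sorts L \<and> countable X \<and> (\<forall>s\<in>sorts L. infinite {n. (n, s) \<notin> X})"

text \<open>Once \<open>x = X\<close> is fixed, an \<open>L\<close>-formula \<open>\<phi>\<close> is partitioned as \<open>\<phi>(x, y)\<close> with \<open>y\<close> the free
  variables outside \<open>X\<close>.\<close>

definition pvars :: "'s var set \<Rightarrow> ('s, 'f, 'r, 'u) fm \<Rightarrow> 's var set" where
  "pvars X \<phi> = fv \<phi> - X"

definition restr_fms ::
    "('s \<times> 'u) set \<Rightarrow> 's var set \<Rightarrow> ('s, 'f, 'r, 'u) fm set \<Rightarrow> ('s, 'f, 'r, 'u) fm set \<Rightarrow>
     ('s, 'f, 'r, 'u) fm set" where
  "restr_fms A X p \<Delta> =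
     {\<psi>\<in>p. \<exists>\<phi>\<in>\<Delta>. \<exists>a\<in>tup A (pvars X \<phi>).
        \<psi> = inst (pvars X \<phi>) a \<phi> \<or> \<psi> = Neg (inst (pvars X \<phi>) a \<phi>)}"

definition restr_params ::
    "('s \<times> 'u) set \<Rightarrow> ('s, 'f, 'r, 'u) fm set \<Rightarrow> ('s, 'f, 'r, 'u) fm set" where
  "restr_params A\<^sub>0 \<pi> = {\<psi>\<in>\<pi>. params \<psi> \<subseteq> A\<^sub>0}"

definition compresses ::
    "('s, 'f, 'r) lang \<Rightarrow> ('s, 'f, 'r, 'u) fo_struct \<Rightarrow> ('s \<times> 'u) set \<Rightarrow> 's var set \<Rightarrow>
     ('s, 'f, 'r, 'u) fm \<Rightarrow> ('s, 'f, 'r, 'u) fm set \<Rightarrow> ('s, 'f, 'r, 'u) fm set \<Rightarrow> bool" where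
  "compresses L U A X \<zeta> \<pi> \<pi>' \<longleftrightarrow>
     (\<forall>A\<^sub>0. finite A\<^sub>0 \<and> A\<^sub>0 \<subseteq> A \<longrightarrow>
        (\<exists>a\<in>tup A (pvars X \<zeta>).
           implies_in L U X \<pi>' {inst (pvars X \<zeta>) a \<zeta>} \<and>
           implies_in L U X {inst (pvars X \<zeta>) a \<zeta>} (restr_params A\<^sub>0 \<pi>)))"

definition compressible_within ::
    "('s, 'f, 'r) lang \<Rightarrow> ('s, 'f, 'r, 'u) fo_struct \<Rightarrow> ('s \<times> 'u) set \<Rightarrow> 's var set \<Rightarrow>
     ('s, 'f, 'r, 'u) fm set \<Rightarrow> ('s, 'f, 'r, 'u) fm set \<Rightarrow> bool" where
  "compressible_within L U A X \<pi> \<pi>' \<longleftrightarrow> (\<exists>\<zeta>. lfm L \<zeta> \<and> compresses L U A X \<zeta> \<pi> \<pi>')"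

definition t_compressible ::
    "('s, 'f, 'r) lang \<Rightarrow> ('s, 'f, 'r, 'u) fo_struct \<Rightarrow> ('s \<times> 'u) set \<Rightarrow> 's var set \<Rightarrow>
     ('s, 'f, 'r, 'u) fm set \<Rightarrow> bool" where
  "t_compressible L U A X \<pi> \<longleftrightarrow> compressible_within L U A X \<pi> \<pi>"

definition compressible ::
    "('s, 'f, 'r) lang \<Rightarrow> ('s, 'f, 'r, 'u) fo_struct \<Rightarrow> ('s \<times> 'u) set \<Rightarrow> 's var set \<Rightarrow>
     ('s, 'f, 'r, 'u) fm set \<Rightarrow> bool" where
  "compressible L U A X p \<longleftrightarrow>
     (\<forall>\<phi>. lfm L \<phi> \<longrightarrow> compressible_within L U A X (restr_fms A X p {\<phi>}) p)"

definition strongly_compressible ::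
    "('s, 'f, 'r) lang \<Rightarrow> ('s, 'f, 'r, 'u) fo_struct \<Rightarrow> ('s \<times> 'u) set \<Rightarrow> 's var set \<Rightarrow>
     ('s, 'f, 'r, 'u) fm set \<Rightarrow> bool" where
  "strongly_compressible L U A X p \<longleftrightarrow>
     (\<forall>\<phi>. lfm L \<phi> \<longrightarrow>
        (\<exists>\<Delta>. finite \<Delta> \<and> \<phi> \<in> \<Delta> \<and> (\<forall>\<delta>\<in>\<Delta>. lfm L \<delta>) \<and>
           t_compressible L U A X (restr_fms A X p \<Delta>)))"

end

(* For a formula phi(x,y), the phi-types over A consistent with a t-compressible pi form a class
   of finite VC dimension. The argument of Chen, Cheng and Tang bounding the teaching dimension
   of finite VC classes applies to filters of realisations in place of finite classes: say that
   F <= F0 is k-compressed if every set in F contains, modulo F0, a condition on k instances of phi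
   that belongs to F. Zorn's lemma gives minimal k-compressed filters, and for suitable k a minimal
   one realises strictly fewer patterns on n-tuples of instances than F0 does. After finitely many
   steps every instance is decided, which yields a phi-type q such that pi together with q is again
   t-compressible. Iterating over all formulas, starting with one that compresses pi, and realising
   the union by saturation gives the strongly compressible type. *)

theory Submission
  imports Defs
begin

section \<open>Compressed filters\<close>

text \<open>The obstacle is uniformity: one formula \<zeta>(x,z) has to serve all finite
  \<open>A\<^sub>0\<close>, with only its parameters varying. Hence the number \<open>k\<close> of
  instances in a condition is bounded before \<open>A\<^sub>0\<close> is known. There are then
  finitely many truth patterns of length at most \<open>k\<close>, and one of them serves cofinally
  many \<open>A\<^sub>0\<close>. Minimal filters lose patterns because conditions can trade: if an
  \<open>n\<close>-tuple \<open>z\<close> still shows the maximal number of patterns, a condition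
  can give up \<open>n\<close> of its instances for a pattern of \<open>z\<close> without growing.
  The constant \<open>2 ^ n * n\<close> comes from the count behind this trade: fewer than
  \<open>2 ^ n\<close> patterns, each forcing fewer than \<open>n\<close> instances of a condition,
  leave some instance of a large condition unforced by all of them. Filters express "modulo \<pi>"
  directly: a set belongs to the filter of \<pi> iff a finite part of \<pi> implies it, so the
  construction needs no realisation of \<pi>. The formula compressing \<pi> is treated first because
  \<pi> itself need not lie in \<open>p\<close> restricted to finitely many formulas. Instances of
  the compressing formula do, and together they imply \<pi>.\<close>

definition agree :: "('i \<Rightarrow> 'e \<Rightarrow> bool) \<Rightarrow> 'i set \<Rightarrow> ('i \<Rightarrow> bool) \<Rightarrow> 'e \<Rightarrow> bool" where
  "agree R Y b e \<longleftrightarrow> (\<forall>i\<in>Y. R i e = b i)"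

text \<open>The two filters mirror the two sides of compression: the condition holds in
  \<open>F\<close>, as a compressing instance follows from the larger type, whereas the implication
  to \<open>G\<close> holds already in \<open>F\<^sub>0\<close>.\<close>

definition compressed ::
    "('i \<Rightarrow> 'e \<Rightarrow> bool) \<Rightarrow> 'i set \<Rightarrow> nat \<Rightarrow> 'e filter \<Rightarrow> 'e filter \<Rightarrow> bool" where
  "compressed R I k F F\<^sub>0 \<longleftrightarrow> F \<le> F\<^sub>0 \<and> F \<noteq> bot \<and>
     (\<forall>G. eventually G F \<longrightarrow>
        (\<exists>Y b. finite Y \<and> Y \<subseteq> I \<and> card Y \<le> k \<and> eventually (agree R Y b) F \<and>
           eventually (\<lambda>e. agree R Y b e \<longrightarrow> G e) F\<^sub>0))"

text \<open>A pattern counts as soon as it is compatible with the filter. Tuples are lists with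
  repetitions allowed, so that an entry can be overwritten in place and a constant tuple tests a
  single instance.\<close>

definition patterns :: "('i \<Rightarrow> 'e \<Rightarrow> bool) \<Rightarrow> 'e filter \<Rightarrow> 'i list \<Rightarrow> bool list set" where
  "patterns R F z = {s. \<exists>\<^sub>F e in F. map (\<lambda>i. R i e) z = s}"

lemma compressedD:
  assumes "compressed R I k F F\<^sub>0" "eventually G F"
  obtains Y b where "finite Y" "Y \<subseteq> I" "card Y \<le> k" "eventually (agree R Y b) F"
    "eventually (\<lambda>e. agree R Y b e \<longrightarrow> G e) F\<^sub>0"
  using assms unfolding compressed_def by blast

lemma compressed_le: "compressed R I k F F\<^sub>0 \<Longrightarrow> F \<le> F\<^sub>0"
  and compressed_nonbot: "compressed R I k F F\<^sub>0 \<Longrightarrow> F \<noteq> bot"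
  unfolding compressed_def by (elim conjE, assumption)+

lemma patterns_length: "patterns R F z \<subseteq> {s. length s = length z}"
  unfolding patterns_def
  by (smt (verit) frequently_ex length_map mem_Collect_eq subsetI)

lemma finite_patterns: "finite (patterns R F z)"
  using patterns_length finite_lists_length_eq[of "UNIV :: bool set" "length z"]
  by (metis (mono_tags, lifting) Collect_cong finite_code finite_subset subset_UNIV)

lemma frequently_mono_filter: "F \<le> F' \<Longrightarrow> frequently P F \<Longrightarrow> frequently P F'"
  unfolding frequently_def using filter_leD by blast

lemma patterns_mono: "F \<le> F' \<Longrightarrow> patterns R F z \<subseteq> patterns R F' z"
  unfolding patterns_def using frequently_mono_filter by blast

section \<open>Two combinatorial tools: edges of the Boolean cube, pigeonhole in a directed
  order\<close>

text \<open>Connectedness of the Boolean cube: a set closed under all single flips contains, along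
  with \<open>s\<close>, every \<open>t\<close>, since \<open>t\<close> is reached from
  \<open>s\<close> by correcting one bit at a time.\<close>

lemma exists_flip_notin:
  fixes S :: "bool list set"
  assumes "S \<noteq> {}" and len: "S \<subseteq> {s. length s = n}" and "S \<noteq> {s. length s = n}"
  shows "\<exists>s\<in>S. \<exists>j<n. s[j := \<not> s ! j] \<notin> S"
proof (rule ccontr)
  assume "\<not> ?thesis"
  then have flip: "s[j := \<not> s ! j] \<in> S" if "s \<in> S" "j < n" for s j
    using that by blast
  have upd: "s[j := c] \<in> S" if "s \<in> S" "j < n" for s j c
    using flip[OF that] that by (cases "c = s ! j") auto
  obtain s where s: "s \<in> S" using assms(1) by blast
  then have ls: "length s = n" using len by blast
  have "t \<in> S" if lt: "length t = n" for t
  proof -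
    have "m \<le> n \<Longrightarrow> take m t @ drop m s \<in> S" for m
    proof (induction m)
      case (Suc m)
      have "take (Suc m) t @ drop (Suc m) s = (take m t @ drop m s)[m := t ! m]"
        using Suc.prems lt ls
        by (simp add: take_Suc_conv_app_nth list_update_append upd_conv_take_nth_drop)
      then show ?case using Suc upd[of "take m t @ drop m s" m] by simp
    qed (use s in simp)
    from this[of n] show ?thesis using lt ls by simp
  qed
  then show False using assms len by blast
qed

text \<open>If finitely many pieces cover a directed order, one piece is cofinal. Directedness,
  finiteness and covering are packed into the hypothesis on families \<open>f\<close>; one
  counterexample for each \<open>s\<close> forms a family that refutes it. It is applied to
  conditions in a filter and to finite parameter sets.\<close>

lemma directed_pigeonhole:
  assumes "\<And>f. (\<And>s. s \<in> S \<Longrightarrow> ok (f s)) \<Longrightarrow>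
    \<exists>a s. ok a \<and> (\<forall>s\<in>S. le a (f s)) \<and> s \<in> S \<and> work s a"
  shows "\<exists>s\<in>S. \<forall>a. ok a \<longrightarrow> (\<exists>a'. ok a' \<and> le a' a \<and> work s a')"
proof (rule ccontr)
  assume "\<not> ?thesis"
  then have "\<forall>s\<in>S. \<exists>a. ok a \<and> (\<forall>a'. ok a' \<longrightarrow> le a' a \<longrightarrow> \<not> work s a')" by blast
  from bchoice[OF this] obtain f where
    f: "\<forall>s\<in>S. ok (f s) \<and> (\<forall>a'. ok a' \<longrightarrow> le a' (f s) \<longrightarrow> \<not> work s a')" ..
  then show False using assms[of f] by blast
qed

section \<open>Minimal compressed filters and composition of compressions\<close>

text \<open>In a nonempty chain, a set belongs to the infimum iff it belongs to some filter of the
  chain. That filter supplies the compressing condition, with the same \<open>k\<close>, and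
  properness is inherited in the same way.\<close>

lemma minimal_compressed_exists:
  assumes "F\<^sub>0 \<noteq> bot"
  shows "\<exists>F. compressed R I k F F\<^sub>0 \<and> (\<forall>F'. compressed R I k F' F\<^sub>0 \<longrightarrow> F' \<le> F \<longrightarrow> F' = F)"
proof -
  let ?C = "{F. compressed R I k F F\<^sub>0}"
  let ?P = "\<lambda>F F' :: _ filter. F' \<le> F"
  \<comment> \<open>The empty condition compresses \<open>F\<^sub>0\<close> modulo itself.\<close>
  have start: "F\<^sub>0 \<in> ?C"
    using assms unfolding compressed_def agree_def by (auto intro!: exI[of _ "{}"])
  have "\<exists>m\<in>?C. \<forall>a\<in>?C. ?P m a \<longrightarrow> a = m"
  proof (rule predicate_Zorn)
    show "partial_order_on ?C (relation_of ?P ?C)"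
      by (rule partial_order_on_relation_ofI) auto
  next
    fix \<C> assume "\<C> \<in> Chains (relation_of ?P ?C)"
    then have lin: "F \<le> F' \<or> F' \<le> F" if "F \<in> \<C>" "F' \<in> \<C>" for F F'
      using that unfolding Chains_def relation_of_def by auto
    from \<open>\<C> \<in> Chains (relation_of ?P ?C)\<close> have sub: "\<C> \<subseteq> ?C"
      unfolding Chains_def relation_of_def by auto
    show "\<exists>u\<in>?C. \<forall>a\<in>\<C>. ?P a u"
    proof (cases "\<C> = {}")
      case True
      then show ?thesis using start by blast
    next
      case False
      have ev: "eventually G (Inf \<C>) \<longleftrightarrow> (\<exists>F\<in>\<C>. eventually G F)" for G
      proof (rule eventually_Inf_base[OF False])
        fix F F' assume "F \<in> \<C>" "F' \<in> \<C>"
        then show "\<exists>x\<in>\<C>. x \<le> inf F F'" using lin[of F F'] by auto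
      qed
      have "Inf \<C> \<le> F\<^sub>0"
      proof -
        obtain F where "F \<in> \<C>" using False by blast
        then show ?thesis using sub Inf_lower2[of F \<C> F\<^sub>0] compressed_le by blast
      qed
      moreover have "Inf \<C> \<noteq> bot"
      proof
        assume "Inf \<C> = bot"
        then obtain F where "F \<in> \<C>" "eventually (\<lambda>_. False) F" using ev[of "\<lambda>_. False"] by auto
        then have "F = bot" by (simp add: trivial_limit_def)
        then show False using sub \<open>F \<in> \<C>\<close> compressed_nonbot by blast
      qed
      moreover have "\<exists>Y b. finite Y \<and> Y \<subseteq> I \<and> card Y \<le> k \<and> eventually (agree R Y b) (Inf \<C>) \<and>
           eventually (\<lambda>e. agree R Y b e \<longrightarrow> G e) F\<^sub>0" if G: "eventually G (Inf \<C>)" for G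
      proof -
        obtain F where F: "F \<in> \<C>" "eventually G F" using G unfolding ev by blast
        then have "compressed R I k F F\<^sub>0" using sub by blast
        then obtain Y b where "finite Y" "Y \<subseteq> I" "card Y \<le> k" "eventually (agree R Y b) F"
          "eventually (\<lambda>e. agree R Y b e \<longrightarrow> G e) F\<^sub>0"
          using F(2) by (rule compressedD)
        moreover from this(4) have "eventually (agree R Y b) (Inf \<C>)"
          unfolding ev using F(1) by (rule bexI)
        ultimately show ?thesis by (intro exI conjI)
      qed
      ultimately have "Inf \<C> \<in> ?C" unfolding compressed_def by simp
      then show ?thesis by (auto intro: Inf_lower)
    qed
  qed
  then show ?thesis by blast
qed

text \<open>Conditions compose: the implication to \<open>G\<close> found modulo
  \<open>F\<^sub>1\<close> is an event of \<open>F\<^sub>1\<close>, so it is itself compressed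
  modulo \<open>F\<^sub>0\<close>, at the cost of at most \<open>l\<close> further
  instances.\<close>

lemma compressed_trans:
  assumes "compressed R I k F F\<^sub>1" "compressed R I l F\<^sub>1 F\<^sub>0"
  shows "compressed R I (k + l) F F\<^sub>0"
  unfolding compressed_def
proof (intro conjI allI impI)
  show "F \<le> F\<^sub>0" using compressed_le[OF assms(1)] compressed_le[OF assms(2)] by (rule order_trans)
  show "F \<noteq> bot" using assms(1) by (rule compressed_nonbot)
  fix G assume "eventually G F"
  with assms(1) obtain Y b where Y: "finite Y" "Y \<subseteq> I" "card Y \<le> k" "eventually (agree R Y b) F"
    "eventually (\<lambda>e. agree R Y b e \<longrightarrow> G e) F\<^sub>1" by (rule compressedD)
  from assms(2) Y(5) obtain Y' b' where Y': "finite Y'" "Y' \<subseteq> I" "card Y' \<le> l"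
    "eventually (agree R Y' b') F\<^sub>1"
    "eventually (\<lambda>e. agree R Y' b' e \<longrightarrow> agree R Y b e \<longrightarrow> G e) F\<^sub>0" by (rule compressedD)
  have ev: "eventually (\<lambda>e. agree R Y b e \<and> agree R Y' b' e) F"
    using Y(4) filter_leD[OF compressed_le[OF assms(1)] Y'(4)] by (simp add: eventually_conj_iff)
  then obtain e\<^sub>0 where e0: "agree R Y b e\<^sub>0" "agree R Y' b' e\<^sub>0"
    using compressed_nonbot[OF assms(1)] eventually_happens by blast
  \<comment> \<open>Values read off a common solution glue the two assignments, which therefore
    cannot conflict on the overlap of \<open>Y\<close> and \<open>Y'\<close>.\<close>
  let ?b = "\<lambda>i. R i e\<^sub>0"
  have iff: "agree R (Y \<union> Y') ?b e \<longleftrightarrow> agree R Y b e \<and> agree R Y' b' e" for e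
    using e0 unfolding agree_def by auto
  show "\<exists>Y b. finite Y \<and> Y \<subseteq> I \<and> card Y \<le> k + l \<and> eventually (agree R Y b) F \<and>
           eventually (\<lambda>e. agree R Y b e \<longrightarrow> G e) F\<^sub>0"
  proof (intro exI conjI)
    show "card (Y \<union> Y') \<le> k + l" using card_Un_le[of Y Y'] Y Y' by linarith
    show "eventually (agree R (Y \<union> Y') ?b) F"
      using ev by (rule eventually_mono) (simp add: iff)
    show "eventually (\<lambda>e. agree R (Y \<union> Y') ?b e \<longrightarrow> G e) F\<^sub>0"
      using Y'(5) by eventually_elim (auto simp: iff)
  qed (use Y Y' in auto)
qed

text \<open>If no single \<open>s\<close> works, there is \<open>w \<in> Y\<close> undetermined by each realised pattern on \<open>z\<close>. Writing
  \<open>w\<close> in a position of \<open>z\<close> at which the set of patterns is not invariant under flipping then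
  produces more patterns than allowed.\<close>

lemma exchange:
  assumes F: "compressed R I k F F\<^sub>0" and k: "k = 2 ^ n * n"
    and bound: "\<And>z. z \<in> lists I \<Longrightarrow> length z = n \<Longrightarrow> card (patterns R F\<^sub>0 z) \<le> m"
    and m: "m < 2 ^ n" "0 < m"
    and z: "z \<in> lists I" "length z = n" "card (patterns R F z) \<ge> m"
    and Y: "finite Y" "Y \<subseteq> I" "card Y \<le> k" "eventually (agree R Y b) F"
  shows "\<exists>s\<in>patterns R F z. \<exists>W\<subseteq>Y. card W + n \<le> k \<and>
    eventually (\<lambda>e. map (\<lambda>i. R i e) z = s \<and> agree R W b e \<longrightarrow> agree R Y b e) F\<^sub>0"
proof -
  have le: "F \<le> F\<^sub>0" using F by (rule compressed_le)
  have sub: "patterns R F z \<subseteq> patterns R F\<^sub>0 z" by (rule patterns_mono[OF le])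
  \<comment> \<open>\<open>F\<close> loses no pattern on \<open>z\<close>: there are exactly
    \<open>m\<close>, the maximum for \<open>n\<close>-tuples modulo
    \<open>F\<^sub>0\<close>.\<close>
  have eq: "patterns R F\<^sub>0 z = patterns R F z"
    using card_seteq[OF finite_patterns sub] bound[OF z(1,2)] z(3) by simp
  then have card: "card (patterns R F z) = m" using z bound[OF z(1,2)] by simp
  let ?P = "patterns R F z"
  \<comment> \<open>The instances of \<open>Y\<close> that the pattern \<open>s\<close> forces,
    modulo \<open>F\<^sub>0\<close>, to the value prescribed by \<open>b\<close>. Dropping
    \<open>n\<close> of them pays for the \<open>n\<close> entries of \<open>z\<close>.\<close>
  let ?B = "\<lambda>s. {w\<in>Y. eventually (\<lambda>e. map (\<lambda>i. R i e) z = s \<longrightarrow> R w e = b w) F\<^sub>0}"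
  have "?P \<noteq> {}" using card m by auto
  consider (small) "card Y + n \<le> k" | (large) s where "s \<in> ?P" "n \<le> card (?B s)"
    | (none) "k < card Y + n" "\<And>s. s \<in> ?P \<Longrightarrow> card (?B s) < n"
    by fastforce
  then show ?thesis
  proof cases
    case small
    then show ?thesis using \<open>?P \<noteq> {}\<close> by (metis (mono_tags, lifting) always_eventually ex_in_conv subset_refl)
  next
    case large
    have "eventually (\<lambda>e. \<forall>w\<in>?B s. map (\<lambda>i. R i e) z = s \<longrightarrow> R w e = b w) F\<^sub>0"
      using Y(1) by (intro eventually_ball_finite) auto
    then have "eventually (\<lambda>e. map (\<lambda>i. R i e) z = s \<and> agree R (Y - ?B s) b e \<longrightarrow> agree R Y b e) F\<^sub>0"
      by (rule eventually_mono) (auto simp: agree_def)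
    moreover have "card (Y - ?B s) + n \<le> k"
    proof -
      have "card (?B s) \<le> card Y" using Y(1) by (intro card_mono) auto
      then show ?thesis using card_Diff_subset[of "?B s" Y] Y large by auto
    qed
    ultimately show ?thesis using large(1) by (intro bexI[of _ s] exI[of _ "Y - ?B s"]) auto
  next
    case none
    have fin: "finite ?P" by (rule finite_patterns)
    have "n > 0" using none(2) \<open>?P \<noteq> {}\<close> by fastforce
    \<comment> \<open>Here the value of \<open>k\<close> enters: the forced instances number at most
      \<open>m * (n - 1)\<close>, and
      \<open>m * (n - 1) + n \<le> 2 ^ n * n = k < card Y + n\<close>.\<close>
    have "card (\<Union>s\<in>?P. ?B s) \<le> (\<Sum>s\<in>?P. card (?B s))" by (rule card_UN_le[OF fin])
    also have "\<dots> \<le> (\<Sum>s\<in>?P. n - 1)" using none(2) by (intro sum_mono) fastforce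
    also have "\<dots> = m * (n - 1)" using card by simp
    also have "\<dots> < card Y"
    proof -
      have "m * (n - 1) + n \<le> Suc m * n" by (simp add: diff_mult_distrib2)
      also have "\<dots> \<le> 2 ^ n * n" using m(1) by (intro mult_le_mono1) simp
      finally show ?thesis using none(1) k by linarith
    qed
    finally have "\<not> Y \<subseteq> (\<Union>s\<in>?P. ?B s)"
      using card_mono[of "\<Union>s\<in>?P. ?B s" Y] Y(1) fin by fastforce
    then obtain w where w: "w \<in> Y" "\<And>s. s \<in> ?P \<Longrightarrow> w \<notin> ?B s" by blast
    \<comment> \<open>The value \<open>b w\<close> occurs with \<open>s\<close> because the
      condition on \<open>Y\<close> belongs to \<open>F\<close> and \<open>s\<close> is compatible
      with \<open>F\<close>; the opposite value occurs modulo \<open>F\<^sub>0\<close> because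
      \<open>w\<close> is not in \<open>?B s\<close>.\<close>
    have both: "\<exists>\<^sub>F e in F\<^sub>0. map (\<lambda>i. R i e) z = s \<and> R w e = c" if s: "s \<in> ?P" for s c
    proof (cases "c = b w")
      case True
      have "\<exists>\<^sub>F e in F. map (\<lambda>i. R i e) z = s" using s unfolding patterns_def by simp
      moreover have "eventually (\<lambda>e. R w e = b w) F"
        using Y(4) by (rule eventually_mono) (use w in \<open>auto simp: agree_def\<close>)
      ultimately have "\<exists>\<^sub>F e in F. map (\<lambda>i. R i e) z = s \<and> R w e = c"
        using True by (simp add: frequently_eventually_frequently)
      then show ?thesis by (rule frequently_mono_filter[OF le])
    next
      case False
      have "\<not> eventually (\<lambda>e. map (\<lambda>i. R i e) z = s \<longrightarrow> R w e = b w) F\<^sub>0"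
        using w s by blast
      then show ?thesis unfolding frequently_def
        by (rule contrapos_nn) (erule eventually_mono, use False in auto)
    qed
    have "\<exists>s\<in>?P. \<exists>j<n. s[j := \<not> s ! j] \<notin> ?P"
    proof (rule exists_flip_notin)
      show "?P \<subseteq> {s. length s = n}" using patterns_length z(2) by metis
      have "card {s :: bool list. length s = n} = 2 ^ n"
        using card_lists_length_eq[of "UNIV :: bool set" n] by simp
      then show "?P \<noteq> {s. length s = n}" using card m by auto
    qed fact
    then obtain s j where s: "s \<in> ?P" and j: "j < n" and flip: "s[j := \<not> s ! j] \<notin> ?P" by blast
    let ?z = "z[j := w]"
    have upd: "t[j := c] \<in> patterns R F\<^sub>0 ?z" if "t \<in> ?P" for t c
      using both[OF that, of c] unfolding patterns_def
      by (auto elim!: frequently_elim1 simp: map_update)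
    \<comment> \<open>An old pattern \<open>t\<close> survives by giving \<open>w\<close> the value
      \<open>t ! j\<close>; the flipped pattern is new, which makes \<open>m + 1\<close>.\<close>
    have "insert (s[j := \<not> s ! j]) ?P \<subseteq> patterns R F\<^sub>0 ?z"
    proof (intro insert_subsetI subsetI)
      show "s[j := \<not> s ! j] \<in> patterns R F\<^sub>0 ?z" by (rule upd[OF s])
      fix t assume "t \<in> ?P"
      from upd[OF this, of "t ! j"] show "t \<in> patterns R F\<^sub>0 ?z" by simp
    qed
    then have "card (insert (s[j := \<not> s ! j]) ?P) \<le> card (patterns R F\<^sub>0 ?z)"
      by (rule card_mono[OF finite_patterns])
    also have "\<dots> \<le> m"
    proof (rule bound)
      show "?z \<in> lists I" using z w Y(2) set_update_subset_insert[of z j w] by auto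
    qed (use z in simp)
    finally show ?thesis using flip fin card by simp
  qed
qed

text \<open>The pattern that the exchange yields depends on the condition. Conditions in
  \<open>F\<close> are directed and patterns finitely many, so one \<open>s\<close> serves
  arbitrarily strong conditions. Adding \<open>s\<close> to a minimal \<open>F\<close> then keeps it
  compressed, so \<open>F\<close> already forces \<open>s\<close> on \<open>z\<close>, against
  \<open>1 < m\<close>.\<close>

lemma compressed_fewer_patterns:
  assumes "F\<^sub>0 \<noteq> bot"
    and bound: "\<And>z. z \<in> lists I \<Longrightarrow> length z = n \<Longrightarrow> card (patterns R F\<^sub>0 z) \<le> m"
    and m: "m < 2 ^ n" "1 < m"
  shows "\<exists>k F. compressed R I k F F\<^sub>0 \<and>
    (\<forall>z\<in>lists I. length z = n \<longrightarrow> card (patterns R F z) < m)"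
proof -
  define k where "k = 2 ^ n * n"
  obtain F where F: "compressed R I k F F\<^sub>0"
    and min: "\<And>F'. compressed R I k F' F\<^sub>0 \<Longrightarrow> F' \<le> F \<Longrightarrow> F' = F"
    using minimal_compressed_exists[OF assms(1)] by metis
  have "card (patterns R F z) < m" if z: "z \<in> lists I" "length z = n" for z
  proof (rule ccontr)
    assume "\<not> ?thesis"
    then have card: "card (patterns R F z) \<ge> m" by simp
    let ?val = "\<lambda>e. map (\<lambda>i. R i e) z"
    \<comment> \<open>Conditions belonging to \<open>F\<close>, ordered by implication modulo
      \<open>F\<^sub>0\<close>; \<open>work s\<close> records that the trade succeeds with the
      pattern \<open>s\<close>.\<close>
    define ok where "ok Yb \<longleftrightarrow> finite (fst Yb) \<and> fst Yb \<subseteq> I \<and> card (fst Yb) \<le> k \<and>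
      eventually (agree R (fst Yb) (snd Yb)) F" for Yb
    define le where "le Yb' Yb \<longleftrightarrow> eventually (\<lambda>e. agree R (fst Yb') (snd Yb') e \<longrightarrow>
      agree R (fst Yb) (snd Yb) e) F\<^sub>0" for Yb' Yb
    define work where "work s Yb \<longleftrightarrow> (\<exists>W\<subseteq>fst Yb. card W + n \<le> k \<and>
      eventually (\<lambda>e. ?val e = s \<and> agree R W (snd Yb) e \<longrightarrow> agree R (fst Yb) (snd Yb) e) F\<^sub>0)"
      for s Yb
    have "\<exists>s\<in>patterns R F z. \<forall>Yb. ok Yb \<longrightarrow> (\<exists>Yb'. ok Yb' \<and> le Yb' Yb \<and> work s Yb')"
    proof (rule directed_pigeonhole)
      fix f assume f: "\<And>s. s \<in> patterns R F z \<Longrightarrow> ok (f s)"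
      \<comment> \<open>Directedness: the conjunction of the finitely many conditions
        \<open>f s\<close> belongs to \<open>F\<close>, and compressing it yields a single condition
        of size at most \<open>k\<close> below all of them.\<close>
      have "eventually (\<lambda>e. \<forall>s\<in>patterns R F z. agree R (fst (f s)) (snd (f s)) e) F"
        using f finite_patterns unfolding ok_def by (intro eventually_ball_finite) auto
      with F obtain Y b where Y: "finite Y" "Y \<subseteq> I" "card Y \<le> k" "eventually (agree R Y b) F"
        "eventually (\<lambda>e. agree R Y b e \<longrightarrow>
           (\<forall>s\<in>patterns R F z. agree R (fst (f s)) (snd (f s)) e)) F\<^sub>0"
        by (rule compressedD)
      have "0 < m" using m by simp
      have "\<exists>s\<in>patterns R F z. work s (Y, b)"
        unfolding work_def fst_conv snd_conv
        by (rule exchange[OF F k_def]) (fact bound m(1) \<open>0 < m\<close> z card Y(1-4))+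
      then obtain s where s: "s \<in> patterns R F z" "work s (Y, b)" by blast
      have "le (Y, b) (f t)" if "t \<in> patterns R F z" for t
        unfolding le_def fst_conv snd_conv using Y(5) by (rule eventually_mono) (use that in auto)
      moreover have "ok (Y, b)" using Y unfolding ok_def by simp
      ultimately show "\<exists>a s. ok a \<and> (\<forall>s\<in>patterns R F z. le a (f s)) \<and> s \<in> patterns R F z \<and> work s a"
        using s by blast
    qed
    then obtain s where s: "s \<in> patterns R F z"
      and work: "\<And>Yb. ok Yb \<Longrightarrow> \<exists>Yb'. ok Yb' \<and> le Yb' Yb \<and> work s Yb'" by blast
    define F' where "F' = inf F (principal {e. ?val e = s})"
    have ev: "eventually G F' \<longleftrightarrow> eventually (\<lambda>e. ?val e = s \<longrightarrow> G e) F" for G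
      unfolding F'_def by (simp add: eventually_inf_principal)
    have bot: "F' \<noteq> bot"
      using s ev[of "\<lambda>_. False"] unfolding patterns_def trivial_limit_def frequently_def by auto
    have le: "F' \<le> F" unfolding F'_def by simp
    have "compressed R I k F' F\<^sub>0"
      unfolding compressed_def
    proof (intro conjI allI impI)
      show "F' \<le> F\<^sub>0" using le compressed_le[OF F] by (rule order_trans)
      fix G assume "eventually G F'"
      then have "eventually (\<lambda>e. ?val e = s \<longrightarrow> G e) F" by (simp add: ev)
      with F obtain Y b where Y: "finite Y" "Y \<subseteq> I" "card Y \<le> k" "eventually (agree R Y b) F"
        "eventually (\<lambda>e. agree R Y b e \<longrightarrow> ?val e = s \<longrightarrow> G e) F\<^sub>0"
        by (rule compressedD)
      from Y have "ok (Y, b)" unfolding ok_def by simp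
      from work[OF this] obtain Y' b' where "ok (Y', b')" "le (Y', b') (Y, b)" "work s (Y', b')"
        by auto
      then obtain W where Y': "finite Y'" "Y' \<subseteq> I" "eventually (agree R Y' b') F"
        "eventually (\<lambda>e. agree R Y' b' e \<longrightarrow> agree R Y b e) F\<^sub>0"
        and W: "W \<subseteq> Y'" "card W + n \<le> k"
        "eventually (\<lambda>e. ?val e = s \<and> agree R W b' e \<longrightarrow> agree R Y' b' e) F\<^sub>0"
        unfolding ok_def le_def work_def by auto
      have "eventually (agree R Y' b') F'" using Y'(3) le filter_leD by blast
      then have evW: "eventually (\<lambda>e. ?val e = s \<and> agree R W b' e) F'"
        unfolding ev by (rule eventually_mono) (use W in \<open>auto simp: agree_def\<close>)
      then obtain e\<^sub>0 where e0: "?val e\<^sub>0 = s" "agree R W b' e\<^sub>0"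
        using bot eventually_happens by blast
      let ?b = "\<lambda>i. R i e\<^sub>0"
      \<comment> \<open>The pattern \<open>s\<close> on \<open>z\<close> is itself a condition on at
        most \<open>n\<close> instances. Joined to \<open>W\<close> it stays within
        \<open>k\<close>, and modulo \<open>F\<^sub>0\<close> it implies the condition on
        \<open>Y'\<close>, hence the one on \<open>Y\<close>, hence \<open>G\<close>.\<close>
      have iff: "agree R (W \<union> set z) ?b e \<longleftrightarrow> ?val e = s \<and> agree R W b' e" for e
        using e0 unfolding agree_def by auto
      show "\<exists>Y b. finite Y \<and> Y \<subseteq> I \<and> card Y \<le> k \<and> eventually (agree R Y b) F' \<and>
           eventually (\<lambda>e. agree R Y b e \<longrightarrow> G e) F\<^sub>0"
      proof (intro exI conjI)
        show "finite (W \<union> set z)" using W Y' finite_subset by auto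
        show "W \<union> set z \<subseteq> I" using W Y' z by auto
        show "card (W \<union> set z) \<le> k"
          using card_Un_le[of W "set z"] card_length[of z] W(2) z(2) by linarith
        show "eventually (agree R (W \<union> set z) ?b) F'"
          using evW by (rule eventually_mono) (simp add: iff)
        show "eventually (\<lambda>e. agree R (W \<union> set z) ?b e \<longrightarrow> G e) F\<^sub>0"
          using Y(5) Y'(4) W(3) by eventually_elim (auto simp: iff)
      qed
    qed (fact bot)
    then have "F' = F" using min le by blast
    then have "eventually (\<lambda>e. ?val e = s) F" using ev[of "\<lambda>e. ?val e = s"] by simp
    then have "t = s" if "t \<in> patterns R F z" for t
      using that frequently_eventually_conj[of "\<lambda>e. ?val e = t" F "\<lambda>e. ?val e = s"]
      unfolding patterns_def by (auto dest: frequently_ex)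
    then have "patterns R F z \<subseteq> {s}" by blast
    then have "card (patterns R F z) \<le> 1" using card_mono[of "{s}"] by fastforce
    then show False using card m by simp
  qed
  then show ?thesis using F by blast
qed

text \<open>Each round lowers the bound \<open>m\<close> at fixed \<open>n\<close>, and the sizes of
  the conditions add up. With at most one pattern left, the constant tuple of length
  \<open>n > 0\<close> shows that its entry is decided.\<close>

lemma compressed_deciding_exists:
  assumes "F\<^sub>0 \<noteq> bot"
    and "\<And>z. z \<in> lists I \<Longrightarrow> length z = n \<Longrightarrow> card (patterns R F\<^sub>0 z) \<le> m"
    and "m < 2 ^ n" "0 < n"
  shows "\<exists>k F. compressed R I k F F\<^sub>0 \<and>
    (\<forall>i\<in>I. eventually (R i) F \<or> eventually (\<lambda>e. \<not> R i e) F)"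
  using assms
proof (induction m arbitrary: F\<^sub>0 rule: less_induct)
  case (less m)
  show ?case
  proof (cases "m \<le> 1")
    case True
    have "eventually (R i) F\<^sub>0 \<or> eventually (\<lambda>e. \<not> R i e) F\<^sub>0" if "i \<in> I" for i
    proof (rule ccontr)
      let ?z = "replicate n i"
      assume neg: "\<not> ?thesis"
      have "replicate n c \<in> patterns R F\<^sub>0 ?z" for c
        using neg \<open>0 < n\<close> unfolding patterns_def frequently_def by (cases c) auto
      then have "card {replicate n True, replicate n False} \<le> card (patterns R F\<^sub>0 ?z)"
        by (intro card_mono[OF finite_patterns]) blast
      also have "\<dots> \<le> m" using that by (intro less.prems(2)) auto
      finally show False using True \<open>0 < n\<close> by (cases n) auto
    qed
    moreover have "compressed R I 0 F\<^sub>0 F\<^sub>0"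
      using less.prems(1) unfolding compressed_def agree_def by (auto intro!: exI[of _ "{}"])
    ultimately show ?thesis by blast
  next
    case False
    then have "1 < m" by simp
    have "\<exists>k F. compressed R I k F F\<^sub>0 \<and>
      (\<forall>z\<in>lists I. length z = n \<longrightarrow> card (patterns R F z) < m)"
      by (rule compressed_fewer_patterns) (fact less.prems \<open>1 < m\<close>)+
    then obtain k F\<^sub>1 where F1: "compressed R I k F\<^sub>1 F\<^sub>0"
      "\<And>z. z \<in> lists I \<Longrightarrow> length z = n \<Longrightarrow> card (patterns R F\<^sub>1 z) < m"
      by blast
    have "\<exists>k F. compressed R I k F F\<^sub>1 \<and>
      (\<forall>i\<in>I. eventually (R i) F \<or> eventually (\<lambda>e. \<not> R i e) F)"
    proof (rule less.IH)
      show "m - 1 < m" using False by simp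
      show "F\<^sub>1 \<noteq> bot" using F1(1) by (rule compressed_nonbot)
      show "card (patterns R F\<^sub>1 z) \<le> m - 1" if "z \<in> lists I" "length z = n" for z
        using F1(2)[OF that] by simp
      show "m - 1 < 2 ^ n" "0 < n" using less.prems(3,4) by simp_all
    qed
    then show ?thesis using compressed_trans[OF _ F1(1)] by blast
  qed
qed

section \<open>Syntax and renaming\<close>

lemma finite_fv_trm: "finite (fv_trm t)"
  by (induction t) auto

lemma finite_fv: "finite (fv \<phi>)"
  by (induction \<phi>) (auto simp: finite_fv_trm)

lemma finite_params_trm: "finite (params_trm t)"
  by (induction t) auto

lemma finite_params: "finite (params \<phi>)"
  by (induction \<phi>) (auto simp: finite_params_trm)

lemma fv_trm_sorts: "wf_trm L t \<Longrightarrow> v \<in> fv_trm t \<Longrightarrow> snd v \<in> sorts L"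
  by (induction t) auto

lemma fv_sorts: "wf_fm L \<phi> \<Longrightarrow> v \<in> fv \<phi> \<Longrightarrow> snd v \<in> sorts L"
  by (induction \<phi>) (auto dest: fv_trm_sorts)

lemma params_trm_sorts: "wf_trm L t \<Longrightarrow> c \<in> params_trm t \<Longrightarrow> fst c \<in> sorts L"
  by (induction t) auto

lemma params_sorts: "wf_fm L \<phi> \<Longrightarrow> c \<in> params \<phi> \<Longrightarrow> fst c \<in> sorts L"
  by (induction \<phi>) (auto dest: params_trm_sorts)

section \<open>Coincidence of assignments; instances as changes of assignment\<close>

lemma eval_cong: "(\<And>v. v \<in> fv_trm t \<Longrightarrow> e v = e' v) \<Longrightarrow> eval M e t = eval M e' t"
proof (induction t)
  case (App f ts)
  have "map (eval M e) ts = map (eval M e') ts"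
    by (intro map_cong refl App.IH App.prems) auto
  then show ?case by (simp del: map_eq_conv)
qed auto

lemma sat_cong: "(\<And>v. v \<in> fv \<phi> \<Longrightarrow> e v = e' v) \<Longrightarrow> sat M e \<phi> \<longleftrightarrow> sat M e' \<phi>"
proof (induction \<phi> arbitrary: e e')
  case (Eq t u)
  then show ?case using eval_cong[of t e e' M] eval_cong[of u e e' M] by simp
next
  case (Rel r ts)
  have "map (eval M e) ts = map (eval M e') ts"
    by (intro map_cong refl eval_cong Rel.prems) auto
  then show ?case by (simp del: map_eq_conv)
next
  case (Conj \<phi> \<psi>)
  have "sat M e \<phi> \<longleftrightarrow> sat M e' \<phi>" "sat M e \<psi> \<longleftrightarrow> sat M e' \<psi>"
    by (rule Conj.IH, rule Conj.prems, simp)+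
  then show ?case by simp
next
  case (Neg \<phi>)
  have "sat M e \<phi> \<longleftrightarrow> sat M e' \<phi>" by (rule Neg.IH, rule Neg.prems, simp)
  then show ?case by simp
next
  case (Exi v \<phi>)
  have "sat M (e(v := a)) \<phi> \<longleftrightarrow> sat M (e'(v := a)) \<phi>" for a
    by (intro Exi.IH) (use Exi.prems in \<open>auto simp del: split_paired_All\<close>)
  then show ?case by simp
qed auto

lemma eval_inst: "eval M e (inst_trm Y b t) = eval M (override_on e b Y) t"
  by (induction t) (auto simp: override_on_def intro!: arg_cong[of _ _ "fint M _"])

lemma sat_inst: "sat M e (inst Y b \<phi>) \<longleftrightarrow> sat M (override_on e b Y) \<phi>"
proof (induction \<phi> arbitrary: e Y)
  case (Rel r ts)
  have "map (eval M e) (map (inst_trm Y b) ts) = map (eval M (override_on e b Y)) ts"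
    by (simp add: eval_inst)
  then show ?case by (simp del: map_map map_eq_conv)
next
  case (Exi v \<phi>)
  have "override_on (e(v := a)) b (Y - {v}) = (override_on e b Y)(v := a)" for a
    by (auto simp: override_on_def)
  then show ?case by (simp add: Exi.IH del: fun_upd_apply)
qed (auto simp: eval_inst)

lemma trm_sort_inst: "trm_sort L (inst_trm Y b t) = trm_sort L t"
  by (cases t) auto

lemma wf_trm_inst: "wf_trm L t \<Longrightarrow> wf_trm L (inst_trm Y b t)"
  by (induction t) (auto simp: trm_sort_inst comp_def)

lemma wf_inst: "wf_fm L \<phi> \<Longrightarrow> wf_fm L (inst Y b \<phi>)"
  by (induction \<phi> arbitrary: Y) (auto simp: wf_trm_inst trm_sort_inst comp_def)

lemma fv_trm_inst: "fv_trm (inst_trm Y b t) = fv_trm t - Y"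
  by (induction t) auto

lemma fv_inst: "fv (inst Y b \<phi>) = fv \<phi> - Y"
  by (induction \<phi> arbitrary: Y) (auto simp: fv_trm_inst)

lemma params_trm_inst:
  "params_trm (inst_trm Y b t) = params_trm t \<union> (\<lambda>v. (snd v, b v)) ` (fv_trm t \<inter> Y)"
  by (induction t) auto

lemma params_inst: "params (inst Y b \<phi>) = params \<phi> \<union> (\<lambda>v. (snd v, b v)) ` (fv \<phi> \<inter> Y)"
  by (induction \<phi> arbitrary: Y) (auto simp: params_trm_inst)

lemma inst_fms:
  assumes "wf_fm L \<phi>" "params \<phi> \<subseteq> A" "fv \<phi> - Y \<subseteq> X" "\<And>v. v \<in> fv \<phi> \<inter> Y \<Longrightarrow> (snd v, b v) \<in> A"
  shows "inst Y b \<phi> \<in> fms L A X"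
  using assms unfolding fms_def by (auto simp: wf_inst fv_inst params_inst)

section \<open>Renaming into variables outside the finite set of bound variables\<close>

fun bv :: "('s, 'f, 'r, 'u) fm \<Rightarrow> 's var set" where
  "bv (Neg \<phi>) = bv \<phi>"
| "bv (Conj \<phi> \<psi>) = bv \<phi> \<union> bv \<psi>"
| "bv (Exi v \<phi>) = insert v (bv \<phi>)"
| "bv _ = {}"

lemma finite_bv: "finite (bv \<phi>)"
  by (induction \<phi>) auto

text \<open>\<open>B\<close> collects the variables bound so far, which are left alone. Nothing is captured
  if \<open>\<rho>\<close> and \<open>\<kappa>\<close> avoid \<open>bv\<close>.\<close>

fun rename_trm ::
    "'s var set \<Rightarrow> ('s var \<Rightarrow> 's var) \<Rightarrow> ('s \<times> 'u \<Rightarrow> 's var) \<Rightarrow> ('s, 'f, 'u) trm \<Rightarrow>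
     ('s, 'f, 'u) trm" where
  "rename_trm B \<rho> \<kappa> (Var v) = Var (if v \<in> B then v else \<rho> v)"
| "rename_trm B \<rho> \<kappa> (Par c) = Var (\<kappa> c)"
| "rename_trm B \<rho> \<kappa> (App f ts) = App f (map (rename_trm B \<rho> \<kappa>) ts)"

text \<open>There are two uses: \<rho> produces copies of \<phi>(x,y) with separate parameter
  variables, and \<kappa> turns an \<open>L(A)\<close>-formula into an
  \<open>L\<close>-formula.\<close>

fun rename ::
    "'s var set \<Rightarrow> ('s var \<Rightarrow> 's var) \<Rightarrow> ('s \<times> 'u \<Rightarrow> 's var) \<Rightarrow> ('s, 'f, 'r, 'u) fm \<Rightarrow>
     ('s, 'f, 'r, 'u) fm" where
  "rename B \<rho> \<kappa> Fls = Fls"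
| "rename B \<rho> \<kappa> (Eq t u) = Eq (rename_trm B \<rho> \<kappa> t) (rename_trm B \<rho> \<kappa> u)"
| "rename B \<rho> \<kappa> (Rel r ts) = Rel r (map (rename_trm B \<rho> \<kappa>) ts)"
| "rename B \<rho> \<kappa> (Neg \<phi>) = Neg (rename B \<rho> \<kappa> \<phi>)"
| "rename B \<rho> \<kappa> (Conj \<phi> \<psi>) = Conj (rename B \<rho> \<kappa> \<phi>) (rename B \<rho> \<kappa> \<psi>)"
| "rename B \<rho> \<kappa> (Exi v \<phi>) = Exi v (rename (insert v B) \<rho> \<kappa> \<phi>)"

lemma trm_sort_rename:
  assumes "\<And>v. v \<in> fv_trm t - B \<Longrightarrow> snd (\<rho> v) = snd v"
    and "\<And>c. c \<in> params_trm t \<Longrightarrow> snd (\<kappa> c) = fst c"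
  shows "trm_sort L (rename_trm B \<rho> \<kappa> t) = trm_sort L t"
  using assms by (cases t) auto

lemma wf_rename_trm:
  assumes "wf_trm L t" "\<And>v. v \<in> fv_trm t - B \<Longrightarrow> snd (\<rho> v) = snd v"
    and "\<And>c. c \<in> params_trm t \<Longrightarrow> snd (\<kappa> c) = fst c"
  shows "wf_trm L (rename_trm B \<rho> \<kappa> t)"
  using assms
proof (induction t)
  case (App f ts)
  have "map (trm_sort L) (map (rename_trm B \<rho> \<kappa>) ts) = map (trm_sort L) ts"
    unfolding map_map comp_def by (intro map_cong refl trm_sort_rename App.prems(2,3)) auto
  moreover have "wf_trm L (rename_trm B \<rho> \<kappa> t)" if "t \<in> set ts" for t
  proof (rule App.IH[OF that])
    show "wf_trm L t" using that App.prems(1) by simp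
    show "snd (\<rho> v) = snd v" if "v \<in> fv_trm t - B" for v
      using that \<open>t \<in> set ts\<close> by (intro App.prems(2)) auto
    show "snd (\<kappa> c) = fst c" if "c \<in> params_trm t" for c
      using that \<open>t \<in> set ts\<close> by (intro App.prems(3)) auto
  qed
  ultimately show ?case using App.prems(1) by (auto simp del: map_map)
qed auto

lemma wf_rename:
  assumes "wf_fm L \<phi>" "\<And>v. v \<in> fv \<phi> - B \<Longrightarrow> snd (\<rho> v) = snd v"
    and "\<And>c. c \<in> params \<phi> \<Longrightarrow> snd (\<kappa> c) = fst c"
  shows "wf_fm L (rename B \<rho> \<kappa> \<phi>)"
  using assms
proof (induction \<phi> arbitrary: B)
  case (Eq t u)
  have "trm_sort L (rename_trm B \<rho> \<kappa> t) = trm_sort L t"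
    "trm_sort L (rename_trm B \<rho> \<kappa> u) = trm_sort L u"
    by (rule trm_sort_rename; use Eq.prems in \<open>simp del: split_paired_All\<close>)+
  moreover have "wf_trm L (rename_trm B \<rho> \<kappa> t)" "wf_trm L (rename_trm B \<rho> \<kappa> u)"
    by (rule wf_rename_trm; use Eq.prems in \<open>simp del: split_paired_All\<close>)+
  ultimately show ?case using Eq.prems(1) by simp
next
  case (Rel r ts)
  have "map (trm_sort L) (map (rename_trm B \<rho> \<kappa>) ts) = map (trm_sort L) ts"
    unfolding map_map comp_def by (intro map_cong refl trm_sort_rename Rel.prems(2,3)) auto
  moreover have "wf_trm L (rename_trm B \<rho> \<kappa> t)" if "t \<in> set ts" for t
  proof (rule wf_rename_trm)
    show "wf_trm L t" using that Rel.prems(1) by simp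
    show "snd (\<rho> v) = snd v" if "v \<in> fv_trm t - B" for v
      using that \<open>t \<in> set ts\<close> by (intro Rel.prems(2)) auto
    show "snd (\<kappa> c) = fst c" if "c \<in> params_trm t" for c
      using that \<open>t \<in> set ts\<close> by (intro Rel.prems(3)) auto
  qed
  ultimately show ?case using Rel.prems(1) by (auto simp del: map_map)
next
  case (Conj \<phi> \<psi>)
  have "wf_fm L (rename B \<rho> \<kappa> \<phi>)" "wf_fm L (rename B \<rho> \<kappa> \<psi>)"
    by (rule Conj.IH; use Conj.prems in \<open>simp del: split_paired_All\<close>)+
  then show ?case by simp
next
  case (Exi v \<phi>)
  have "wf_fm L (rename (insert v B) \<rho> \<kappa> \<phi>)"
    by (rule Exi.IH; use Exi.prems in \<open>simp del: split_paired_All\<close>)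
  then show ?case using Exi.prems(1) by simp
qed simp_all

lemma params_rename_trm: "params_trm (rename_trm B \<rho> \<kappa> t) = {}"
  by (induction t) auto

lemma params_rename: "params (rename B \<rho> \<kappa> \<phi>) = {}"
  by (induction \<phi> arbitrary: B) (auto simp: params_rename_trm)

lemma fv_rename_trm:
  "fv_trm (rename_trm B \<rho> \<kappa> t) \<subseteq> B \<union> \<rho> ` (fv_trm t - B) \<union> \<kappa> ` params_trm t"
proof (induction t)
  case (App f ts)
  show ?case
  proof
    fix v assume "v \<in> fv_trm (rename_trm B \<rho> \<kappa> (App f ts))"
    then obtain t where t: "t \<in> set ts" "v \<in> fv_trm (rename_trm B \<rho> \<kappa> t)" by auto
    from App.IH[OF t(1)] t(2) have "v \<in> B \<union> \<rho> ` (fv_trm t - B) \<union> \<kappa> ` params_trm t" by (rule subsetD)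
    with t(1) show "v \<in> B \<union> \<rho> ` (fv_trm (App f ts) - B) \<union> \<kappa> ` params_trm (App f ts)"
      by (auto simp: image_iff simp del: split_paired_All split_paired_Ex)
  qed
qed auto

lemma fv_rename: "fv (rename B \<rho> \<kappa> \<phi>) \<subseteq> B \<union> \<rho> ` (fv \<phi> - B) \<union> \<kappa> ` params \<phi>"
proof (induction \<phi> arbitrary: B)
  case (Rel r ts)
  show ?case
  proof
    fix v assume "v \<in> fv (rename B \<rho> \<kappa> (Rel r ts))"
    then obtain t where t: "t \<in> set ts" "v \<in> fv_trm (rename_trm B \<rho> \<kappa> t)" by auto
    from fv_rename_trm t(2) have "v \<in> B \<union> \<rho> ` (fv_trm t - B) \<union> \<kappa> ` params_trm t" by (rule subsetD)
    with t(1) show "v \<in> B \<union> \<rho> ` (fv (Rel r ts) - B) \<union> \<kappa> ` params (Rel r ts)"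
      by (auto simp: image_iff simp del: split_paired_All split_paired_Ex)
  qed
next
  case (Eq t u)
  show ?case using fv_rename_trm[of B \<rho> \<kappa> t] fv_rename_trm[of B \<rho> \<kappa> u]
    by (simp add: image_Un Un_Diff) blast
next
  case (Conj \<phi> \<psi>)
  show ?case using Conj.IH(1)[of B] Conj.IH(2)[of B] by (simp add: image_Un Un_Diff) blast
next
  case (Exi v \<phi>)
  have "fv \<phi> - insert v B = fv \<phi> - {v} - B" by blast
  then show ?case using Exi.IH[of "insert v B"] by auto
qed auto

lemma eval_rename:
  assumes "\<And>c. c \<in> params_trm t \<Longrightarrow> e (\<kappa> c) = snd c"
  shows "eval M e (rename_trm B \<rho> \<kappa> t) = eval M (\<lambda>v. if v \<in> B then e v else e (\<rho> v)) t"
  using assms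
proof (induction t)
  case (App f ts)
  have "map (eval M e) (map (rename_trm B \<rho> \<kappa>) ts) =
    map (eval M (\<lambda>v. if v \<in> B then e v else e (\<rho> v))) ts"
    unfolding map_map comp_def by (intro map_cong refl App.IH App.prems) auto
  then show ?case by (simp del: map_map map_eq_conv)
qed auto

text \<open>Renaming precomposes the assignment with \<rho>. Freshness matters in the quantifier
  case: updating \<open>e\<close> at the bound variable must not change values read through \<rho>
  or \<kappa>.\<close>

lemma sat_rename:
  assumes "\<And>c. c \<in> params \<phi> \<Longrightarrow> e (\<kappa> c) = snd c \<and> \<kappa> c \<notin> bv \<phi>"
    and "\<And>v. v \<in> fv \<phi> - B \<Longrightarrow> \<rho> v \<notin> bv \<phi>"
  shows "sat M e (rename B \<rho> \<kappa> \<phi>) \<longleftrightarrow> sat M (\<lambda>v. if v \<in> B then e v else e (\<rho> v)) \<phi>"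
  using assms
proof (induction \<phi> arbitrary: B e)
  case (Eq t u)
  then show ?case by (simp add: eval_rename)
next
  case (Rel r ts)
  have "map (eval M e) (map (rename_trm B \<rho> \<kappa>) ts) =
    map (eval M (\<lambda>v. if v \<in> B then e v else e (\<rho> v))) ts"
    unfolding map_map comp_def
    by (intro map_cong refl eval_rename conjunct1[OF Rel.prems(1)]) auto
  then show ?case by (simp del: map_map map_eq_conv)
next
  case (Neg \<phi>)
  have "sat M e (rename B \<rho> \<kappa> \<phi>) \<longleftrightarrow> sat M (\<lambda>v. if v \<in> B then e v else e (\<rho> v)) \<phi>"
    by (rule Neg.IH) (use Neg.prems in \<open>simp_all del: split_paired_All\<close>)
  then show ?case by simp
next
  case (Conj \<phi> \<psi>)
  have "sat M e (rename B \<rho> \<kappa> \<phi>) \<longleftrightarrow> sat M (\<lambda>v. if v \<in> B then e v else e (\<rho> v)) \<phi>"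
    by (rule Conj.IH) (use Conj.prems in \<open>simp_all del: split_paired_All\<close>)
  moreover have
    "sat M e (rename B \<rho> \<kappa> \<psi>) \<longleftrightarrow> sat M (\<lambda>v. if v \<in> B then e v else e (\<rho> v)) \<psi>"
    by (rule Conj.IH) (use Conj.prems in \<open>simp_all del: split_paired_All\<close>)
  ultimately show ?case by simp
next
  case (Exi v \<phi>)
  have "sat M (e(v := a)) (rename (insert v B) \<rho> \<kappa> \<phi>) \<longleftrightarrow>
      sat M ((\<lambda>v. if v \<in> B then e v else e (\<rho> v))(v := a)) \<phi>" for a
  proof -
    have "sat M (e(v := a)) (rename (insert v B) \<rho> \<kappa> \<phi>) \<longleftrightarrow>
      sat M (\<lambda>w. if w \<in> insert v B then (e(v := a)) w else (e(v := a)) (\<rho> w)) \<phi>"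
      using Exi.prems by (intro Exi.IH) auto
    also have "\<dots> \<longleftrightarrow> sat M ((\<lambda>v. if v \<in> B then e v else e (\<rho> v))(v := a)) \<phi>"
      using Exi.prems by (intro sat_cong) auto
    finally show ?thesis .
  qed
  then show ?case by simp
qed auto

text \<open>Since \<open>var_tuple\<close> leaves infinitely many variables of each sort outside
  \<open>X\<close>, the new variables can be picked one after another, also avoiding the finite set
  \<open>N\<close>.\<close>

lemma fresh_variables:
  assumes "finite Q" "finite N" and "\<And>q. q \<in> Q \<Longrightarrow> st q \<in> sorts L" and "var_tuple L X"
  shows "\<exists>\<rho>. inj_on \<rho> Q \<and> (\<forall>q\<in>Q. snd (\<rho> q) = st q \<and> \<rho> q \<notin> X \<union> N)"
  using assms(1,3)
proof (induction Q)
  case (insert q Q)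
  then obtain \<rho> where \<rho>: "inj_on \<rho> Q" "\<forall>q\<in>Q. snd (\<rho> q) = st q \<and> \<rho> q \<notin> X \<union> N" by auto
  have "infinite {n. (n, st q) \<notin> X}" using assms(4) insert unfolding var_tuple_def by simp
  moreover have "finite (fst ` (N \<union> \<rho> ` Q))" using assms(2) insert by auto
  ultimately obtain n where n: "(n, st q) \<notin> X" "n \<notin> fst ` (N \<union> \<rho> ` Q)"
    by (metis (mono_tags, lifting) finite_subset mem_Collect_eq subsetI)
  have new: "(n, st q) \<notin> N" "(n, st q) \<notin> \<rho> ` Q"
    using n(2) by (metis UnI1 UnI2 fst_conv imageI)+
  show ?case
  proof (intro exI conjI ballI)
    show "inj_on (\<rho>(q := (n, st q))) (insert q Q)"
      using inj_on_fun_updI[OF \<rho>(1) new(2), of q] new(2) insert.hyps(2)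
      by (simp add: inj_on_insert fun_upd_image del: fun_upd_apply) simp
    fix r assume "r \<in> insert q Q"
    then show "snd ((\<rho>(q := (n, st q))) r) = st r" "(\<rho>(q := (n, st q))) r \<notin> X \<union> N"
      using \<rho>(2) n(1) new(1) by (cases "r = q"; simp)+
  qed
qed simp

section \<open>Finite conjunctions and blocks of existential quantifiers\<close>

fun bigconj :: "('s, 'f, 'r, 'u) fm list \<Rightarrow> ('s, 'f, 'r, 'u) fm" where
  "bigconj [] = Neg Fls"
| "bigconj (\<phi> # \<phi>s) = Conj \<phi> (bigconj \<phi>s)"

lemma sat_bigconj: "sat M e (bigconj \<phi>s) \<longleftrightarrow> (\<forall>\<phi>\<in>set \<phi>s. sat M e \<phi>)"
  by (induction \<phi>s) auto

lemma wf_bigconj: "wf_fm L (bigconj \<phi>s) \<longleftrightarrow> (\<forall>\<phi>\<in>set \<phi>s. wf_fm L \<phi>)"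
  by (induction \<phi>s) auto

lemma fv_bigconj: "fv (bigconj \<phi>s) = (\<Union>\<phi>\<in>set \<phi>s. fv \<phi>)"
  by (induction \<phi>s) auto

lemma params_bigconj: "params (bigconj \<phi>s) = (\<Union>\<phi>\<in>set \<phi>s. params \<phi>)"
  by (induction \<phi>s) auto

fun exis :: "'s var list \<Rightarrow> ('s, 'f, 'r, 'u) fm \<Rightarrow> ('s, 'f, 'r, 'u) fm" where
  "exis [] \<phi> = \<phi>"
| "exis (v # vs) \<phi> = Exi v (exis vs \<phi>)"

lemma sat_exis:
  "sat M e (exis vs \<phi>) \<longleftrightarrow>
     (\<exists>e'. (\<forall>v\<in>set vs. e' v \<in> carr M (snd v)) \<and> (\<forall>v. v \<notin> set vs \<longrightarrow> e' v = e v) \<and> sat M e' \<phi>)"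
proof (induction vs arbitrary: e)
  case Nil
  have "(\<forall>v. e' v = e v) \<longleftrightarrow> e' = e" for e' by auto
  then show ?case by simp
next
  case (Cons w vs)
  show ?case (is "?L \<longleftrightarrow> ?R")
  proof
    assume ?L
    then obtain a e' where "a \<in> carr M (snd w)" "\<forall>v\<in>set vs. e' v \<in> carr M (snd v)"
      "\<forall>v. v \<notin> set vs \<longrightarrow> e' v = (e(w := a)) v" "sat M e' \<phi>"
      by (auto simp: Cons.IH)
    moreover from this have "e' w \<in> carr M (snd w)"
      by (cases "w \<in> set vs") (auto simp del: split_paired_All)
    ultimately show ?R by (intro exI[of _ e']) auto
  next
    assume ?R
    then obtain e' where e': "\<forall>v\<in>set (w # vs). e' v \<in> carr M (snd v)"
      "\<forall>v. v \<notin> set (w # vs) \<longrightarrow> e' v = e v" "sat M e' \<phi>" by blast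
    then have "sat M (e(w := e' w)) (exis vs \<phi>)" unfolding Cons.IH
      by (intro exI[of _ e']) auto
    then show ?L using e'(1) by auto
  qed
qed

lemma wf_exis: "wf_fm L (exis vs \<phi>) \<longleftrightarrow> (\<forall>v\<in>set vs. snd v \<in> sorts L) \<and> wf_fm L \<phi>"
  by (induction vs) auto

lemma fv_exis: "fv (exis vs \<phi>) = fv \<phi> - set vs"
  by (induction vs) auto

lemma params_exis: "params (exis vs \<phi>) = params \<phi>"
  by (induction vs) auto

section \<open>Countability of the set of formulas without parameters\<close>

lemma map_inj_on_strong:
  assumes "\<And>x y. x \<in> set xs \<Longrightarrow> y \<in> set ys \<Longrightarrow> f x = f y \<Longrightarrow> x = y" "map f xs = map f ys"
  shows "xs = ys"
  using assms list.inj_map_strong by metis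

text \<open>The whole type of formulas contains a constant for every element and every symbol of the
  ambient types, so it need not be countable. The code is therefore injective only on well-formed
  formulas without parameters.\<close>

lemma countable_lfm:
  fixes L :: "('s, 'f, 'r) lang"
  assumes L: "countable_lang L"
  shows "countable {\<phi> :: ('s, 'f, 'r, 'u) fm. lfm L \<phi>}"
proof -
  let ?S = "to_nat_on (sorts L)" and ?F = "to_nat_on (funs L)" and ?R = "to_nat_on (rels L)"
  have inj: "inj_on ?S (sorts L)" "inj_on ?F (funs L)" "inj_on ?R (rels L)"
    using L unfolding countable_lang_def by auto
  define var where "var v = prod_encode (fst v, ?S (snd v))" for v :: "'s var"
  have var: "v = w" if "var v = var w" "snd v \<in> sorts L" "snd w \<in> sorts L" for v w
    using that inj_onD[OF inj(1)] unfolding var_def by (auto simp: prod_eq_iff)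
  \<comment> \<open>Through the nested list the recursor delivers pairs of a subterm and its code,
    hence \<open>map snd\<close>. The code \<open>0\<close> of a parameter is arbitrary, as
    parameters are excluded from the injectivity claim.\<close>
  define tenc :: "('s, 'f, 'u) trm \<Rightarrow> nat" where
    "tenc = rec_trm (\<lambda>v. prod_encode (0, var v)) (\<lambda>_. 0)
      (\<lambda>f ts. prod_encode (1, prod_encode (?F f, list_encode (map snd ts))))"
  have tenc [simp]: "tenc (Var v) = prod_encode (0, var v)"
    "tenc (App f ts) = prod_encode (1, prod_encode (?F f, list_encode (map tenc ts)))" for v f ts
    unfolding tenc_def by (simp_all add: comp_def)
  have tinj: "wf_trm L t \<Longrightarrow> params_trm t = {} \<Longrightarrow> wf_trm L u \<Longrightarrow> params_trm u = {} \<Longrightarrow>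
    tenc t = tenc u \<Longrightarrow> t = u" for t u
  proof (induction t arbitrary: u)
    case (Var v)
    then show ?case by (cases u) (auto dest: var)
  next
    case (App f ts)
    from App.prems(5) obtain g us where u: "u = App g us"
      by (cases u) (use App.prems in auto)
    with App.prems(5) have eq: "?F f = ?F g" "map tenc ts = map tenc us"
      by (simp_all add: list_encode_eq)
    have "f = g" using inj_onD[OF inj(2) eq(1)] App.prems u by simp
    moreover have "ts = us"
      by (rule map_inj_on_strong[OF _ eq(2)], rule App.IH) (use App.prems u in auto)
    ultimately show ?case using u by simp
  qed simp
  define enc :: "('s, 'f, 'r, 'u) fm \<Rightarrow> nat" where
    "enc = rec_fm (prod_encode (0, 0)) (\<lambda>t u. prod_encode (1, prod_encode (tenc t, tenc u)))
      (\<lambda>r ts. prod_encode (2, prod_encode (?R r, list_encode (map tenc ts))))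
      (\<lambda>_ n. prod_encode (3, n)) (\<lambda>_ _ m n. prod_encode (4, prod_encode (m, n)))
      (\<lambda>v _ n. prod_encode (5, prod_encode (var v, n)))"
  have enc [simp]: "enc Fls = prod_encode (0, 0)"
    "enc (Eq t u) = prod_encode (1, prod_encode (tenc t, tenc u))"
    "enc (Rel r ts) = prod_encode (2, prod_encode (?R r, list_encode (map tenc ts)))"
    "enc (Neg \<phi>) = prod_encode (3, enc \<phi>)"
    "enc (Conj \<phi> \<psi>) = prod_encode (4, prod_encode (enc \<phi>, enc \<psi>))"
    "enc (Exi v \<phi>) = prod_encode (5, prod_encode (var v, enc \<phi>))" for t u r ts \<phi> \<psi> v
    unfolding enc_def by simp_all
  have "wf_fm L \<phi> \<Longrightarrow> params \<phi> = {} \<Longrightarrow> wf_fm L \<psi> \<Longrightarrow> params \<psi> = {} \<Longrightarrow>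
    enc \<phi> = enc \<psi> \<Longrightarrow> \<phi> = \<psi>" for \<phi> \<psi>
  proof (induction \<phi> arbitrary: \<psi>)
    case Fls
    then show ?case by (cases \<psi>) auto
  next
    case (Eq t u)
    then show ?case by (cases \<psi>) (auto dest: tinj)
  next
    case (Rel r ts)
    from Rel.prems(5) obtain q us where \<psi>: "\<psi> = Rel q us" by (cases \<psi>) auto
    with Rel.prems(5) have eq: "?R r = ?R q" "map tenc ts = map tenc us"
      by (simp_all add: list_encode_eq)
    have "r = q" using inj_onD[OF inj(3) eq(1)] Rel.prems \<psi> by simp
    moreover have "ts = us"
      by (rule map_inj_on_strong[OF _ eq(2)], rule tinj) (use Rel.prems \<psi> in auto)
    ultimately show ?case using \<psi> by simp
  next
    case (Neg \<phi>)
    then show ?case by (cases \<psi>) auto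
  next
    case (Conj \<phi>\<^sub>1 \<phi>\<^sub>2)
    then show ?case by (cases \<psi>) auto
  next
    case (Exi v \<phi>)
    then show ?case by (cases \<psi>) (auto dest: var)
  qed
  then have "inj_on enc {\<phi> :: ('s, 'f, 'r, 'u) fm. lfm L \<phi>}"
    unfolding lfm_def by (auto intro!: inj_onI)
  then show ?thesis by (rule countableI)
qed

section \<open>Realising types in countably many variables\<close>

lemma tupD: "a \<in> tup A V \<Longrightarrow> v \<in> V \<Longrightarrow> (snd v, a v) \<in> A"
  unfolding tup_def by (auto dest: PiE_mem)

lemma tupI: "(\<And>v. v \<in> V \<Longrightarrow> (snd v, a v) \<in> A) \<Longrightarrow> restrict a V \<in> tup A V"
  unfolding tup_def by (auto simp del: split_paired_All)

lemma tup_mono: "A \<subseteq> B \<Longrightarrow> tup A V \<subseteq> tup B V"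
  unfolding tup_def by (intro PiE_mono) auto

text \<open>Keeps the parameter set small when the finitely many values chosen so far are added to
  it, before saturation is applied to the next variable.\<close>

lemma lesspoll_Un_finite:
  assumes "A \<prec> C" "infinite C" "finite B"
  shows "A \<union> B \<prec> C"
proof (cases "finite A")
  case True
  then show ?thesis using assms by (intro finite_lesspoll_infinite) auto
next
  case False
  have "A \<union> B \<approx> A" using assms(3)
  proof (induction B)
    case (insert b B)
    have "insert b (A \<union> B) \<approx> A \<union> B" using False by (intro infinite_insert_eqpoll) simp
    then show ?case using insert.IH by (simp add: eqpoll_trans)
  qed simp
  then show ?thesis using assms(1) by (rule eq_lesspoll_trans)
qed

text \<open>Saturation concerns a single variable, so the others are removed: those in
  \<open>V\<close> by naming their values, the remaining ones by quantifiers. Quantification is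
  possible only in finite parts of \<Gamma>, so the property passed on is finite satisfiability with
  prescribed values on \<open>V\<close>.\<close>

lemma realizes_next:
  assumes "saturated L U" "infinite (universe L U)" "A \<subseteq> universe L U" "A \<prec> universe L U"
    and X: "X \<subseteq> UNIV \<times> sorts L" and \<Gamma>: "\<Gamma> \<subseteq> fms L A X"
    and V: "finite V" "V \<subseteq> X" and v: "v \<in> X" "v \<notin> V"
    and b: "\<And>\<Gamma>\<^sub>0. finite \<Gamma>\<^sub>0 \<Longrightarrow> \<Gamma>\<^sub>0 \<subseteq> \<Gamma> \<Longrightarrow>
      \<exists>e\<in>tup (universe L U) X. realizes U e \<Gamma>\<^sub>0 \<and> (\<forall>w\<in>V. e w = b w)"
  shows "\<exists>c. \<forall>\<Gamma>\<^sub>0. finite \<Gamma>\<^sub>0 \<and> \<Gamma>\<^sub>0 \<subseteq> \<Gamma> \<longrightarrow>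
      (\<exists>e\<in>tup (universe L U) X. realizes U e \<Gamma>\<^sub>0 \<and> (\<forall>w\<in>V. e w = b w) \<and> e v = c)"
proof -
  let ?list = "\<lambda>S. SOME xs. set xs = S"
  have list: "set (?list S) = S" if "finite S" for S :: "'z set"
    using finite_list[OF that] by (rule someI_ex)
  define W where "W \<Gamma>\<^sub>0 = (\<Union>\<gamma>\<in>\<Gamma>\<^sub>0. fv \<gamma>) - V - {v}" for \<Gamma>\<^sub>0 :: "('a, 'b, 'c, 'd) fm set"
  define F where "F \<Gamma>\<^sub>0 = exis (?list (W \<Gamma>\<^sub>0)) (inst V b (bigconj (?list \<Gamma>\<^sub>0)))"
    for \<Gamma>\<^sub>0 :: "('a, 'b, 'c, 'd) fm set"
  have finW: "finite (W \<Gamma>\<^sub>0)" if "finite \<Gamma>\<^sub>0" for \<Gamma>\<^sub>0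
    unfolding W_def using that finite_fv by auto
  have WX: "W \<Gamma>\<^sub>0 \<subseteq> X" if "\<Gamma>\<^sub>0 \<subseteq> \<Gamma>" for \<Gamma>\<^sub>0
    using that \<Gamma> unfolding W_def fms_def by blast
  have satF: "sat U e (F \<Gamma>\<^sub>0) \<longleftrightarrow> (\<exists>e'. (\<forall>w\<in>W \<Gamma>\<^sub>0. e' w \<in> carr U (snd w)) \<and>
      (\<forall>w. w \<notin> W \<Gamma>\<^sub>0 \<longrightarrow> e' w = e w) \<and> (\<forall>\<gamma>\<in>\<Gamma>\<^sub>0. sat U (override_on e' b V) \<gamma>))"
    if "finite \<Gamma>\<^sub>0" for \<Gamma>\<^sub>0 e
    unfolding F_def sat_exis sat_inst sat_bigconj list[OF that] list[OF finW[OF that]] by (rule refl)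
  obtain e\<^sub>0 where e0: "e\<^sub>0 \<in> tup (universe L U) X" "\<And>w. w \<in> V \<Longrightarrow> e\<^sub>0 w = b w"
    using b[of "{}"] by auto
  let ?B = "A \<union> (\<lambda>w. (snd w, b w)) ` V"
  let ?\<pi> = "F ` {\<Gamma>\<^sub>0. finite \<Gamma>\<^sub>0 \<and> \<Gamma>\<^sub>0 \<subseteq> \<Gamma>}"
  have bU: "(snd w, b w) \<in> universe L U" if "w \<in> V" for w
    using tupD[OF e0(1), of w] e0(2)[OF that] that V(2) by auto
  have "F \<Gamma>\<^sub>0 \<in> fms L ?B {v}" if fin: "finite \<Gamma>\<^sub>0" and sub: "\<Gamma>\<^sub>0 \<subseteq> \<Gamma>" for \<Gamma>\<^sub>0
  proof -
    have "wf_fm L \<gamma>" "params \<gamma> \<subseteq> A" if "\<gamma> \<in> \<Gamma>\<^sub>0" for \<gamma>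
      using that sub \<Gamma> unfolding fms_def by auto
    moreover have "snd w \<in> sorts L" if "w \<in> W \<Gamma>\<^sub>0" for w
      using that WX[OF sub] X by auto
    ultimately show ?thesis
      unfolding fms_def mem_Collect_eq F_def wf_exis params_exis fv_exis params_inst fv_inst
        params_bigconj fv_bigconj list[OF fin] list[OF finW[OF fin]]
      by (intro conjI wf_inst; auto simp: wf_bigconj list[OF fin] W_def)
  qed
  then have sub: "?\<pi> \<subseteq> fms L ?B {v}" by blast
  have "consistent L U {v} ?\<pi>"
    unfolding consistent_def
  proof (intro allI impI)
    fix \<pi>\<^sub>0 assume "\<pi>\<^sub>0 \<subseteq> ?\<pi>" "finite \<pi>\<^sub>0"
    then obtain \<G> where \<G>: "\<G> \<subseteq> {\<Gamma>\<^sub>0. finite \<Gamma>\<^sub>0 \<and> \<Gamma>\<^sub>0 \<subseteq> \<Gamma>}" "finite \<G>" "\<pi>\<^sub>0 = F ` \<G>"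
      by (meson finite_subset_image)
    \<comment> \<open>One solution of the union of finitely many finite parts satisfies all their
      projections at once.\<close>
    then obtain e where e: "e \<in> tup (universe L U) X" "realizes U e (\<Union>\<G>)" "\<And>w. w \<in> V \<Longrightarrow> e w = b w"
      using b[of "\<Union>\<G>"] by blast
    show "\<exists>e\<in>tup (universe L U) {v}. realizes U e \<pi>\<^sub>0"
    proof (rule bexI)
      show "restrict e {v} \<in> tup (universe L U) {v}" using tupD[OF e(1)] v(1) by (intro tupI) auto
      have "sat U (restrict e {v}) (F \<Gamma>\<^sub>0)" if G: "\<Gamma>\<^sub>0 \<in> \<G>" for \<Gamma>\<^sub>0
      proof -
        have fin: "finite \<Gamma>\<^sub>0" and sub: "\<Gamma>\<^sub>0 \<subseteq> \<Gamma>" using G \<G>(1) by auto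
        show ?thesis unfolding satF[OF fin]
        proof (intro exI conjI allI ballI impI)
          let ?e = "\<lambda>w. if w \<in> W \<Gamma>\<^sub>0 then e w else restrict e {v} w"
          show "?e w \<in> carr U (snd w)" if "w \<in> W \<Gamma>\<^sub>0" for w
            using that WX[OF sub] tupD[OF e(1), of w] unfolding universe_def by auto
          show "?e w = restrict e {v} w" if "w \<notin> W \<Gamma>\<^sub>0" for w using that by simp
          fix \<gamma> assume \<gamma>: "\<gamma> \<in> \<Gamma>\<^sub>0"
          have "sat U (override_on ?e b V) \<gamma> \<longleftrightarrow> sat U e \<gamma>"
          proof (rule sat_cong)
            fix w assume "w \<in> fv \<gamma>"
            then have "w \<in> V \<or> w = v \<or> w \<in> W \<Gamma>\<^sub>0" using \<gamma> unfolding W_def by blast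
            then show "override_on ?e b V w = e w"
              using e(3)[of w] unfolding W_def override_on_def by auto
          qed
          then show "sat U (override_on ?e b V) \<gamma>" using e(2) \<gamma> G unfolding realizes_def by auto
        qed
      qed
      then show "realizes U (restrict e {v}) \<pi>\<^sub>0" unfolding \<G>(3) realizes_def by blast
    qed
  qed
  with sub have "partial_type L U ?B {v} ?\<pi>" unfolding partial_type_def by blast
  moreover have "?B \<subseteq> universe L U" using assms(3) bU by auto
  moreover have "?B \<prec> universe L U" using assms V(1) by (intro lesspoll_Un_finite) auto
  moreover have "snd v \<in> sorts L" using v(1) X by auto
  ultimately obtain e\<^sub>1 where e1: "e\<^sub>1 \<in> tup (universe L U) {v}" "realizes U e\<^sub>1 ?\<pi>"
    using assms(1) unfolding saturated_def by blast
  show ?thesis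
  proof (intro exI allI impI)
    fix \<Gamma>\<^sub>0 assume "finite \<Gamma>\<^sub>0 \<and> \<Gamma>\<^sub>0 \<subseteq> \<Gamma>"
    then have fin: "finite \<Gamma>\<^sub>0" and sub: "\<Gamma>\<^sub>0 \<subseteq> \<Gamma>" by auto
    have "sat U e\<^sub>1 (F \<Gamma>\<^sub>0)" using e1(2) fin sub unfolding realizes_def by auto
    then obtain e' where e': "\<And>w. w \<in> W \<Gamma>\<^sub>0 \<Longrightarrow> e' w \<in> carr U (snd w)"
      "\<And>w. w \<notin> W \<Gamma>\<^sub>0 \<Longrightarrow> e' w = e\<^sub>1 w" "\<And>\<gamma>. \<gamma> \<in> \<Gamma>\<^sub>0 \<Longrightarrow> sat U (override_on e' b V) \<gamma>"
      unfolding satF[OF fin] by blast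
    have nW: "w \<notin> W \<Gamma>\<^sub>0" if "w \<in> V \<or> w = v" for w using that unfolding W_def by auto
    \<comment> \<open>The quantified variables take their witnesses and \<open>v\<close> the value
      given by saturation; \<open>e\<^sub>0\<close> supplies the values on \<open>V\<close> and
      correctly sorted elements everywhere else in \<open>X\<close>.\<close>
    let ?e = "\<lambda>w. if w \<in> W \<Gamma>\<^sub>0 then e' w else if w = v then e\<^sub>1 v else e\<^sub>0 w"
    have eX: "restrict ?e X w = ?e w" if "w \<in> X" for w using that by simp
    show "\<exists>e\<in>tup (universe L U) X. realizes U e \<Gamma>\<^sub>0 \<and> (\<forall>w\<in>V. e w = b w) \<and> e v = e\<^sub>1 v"
    proof (intro bexI conjI ballI)
      show "restrict ?e X \<in> tup (universe L U) X"
      proof (rule tupI)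
        fix w assume w: "w \<in> X"
        then have "snd w \<in> sorts L" using X by auto
        then show "(snd w, ?e w) \<in> universe L U"
          using e'(1)[of w] tupD[OF e1(1), of v] tupD[OF e0(1) w] unfolding universe_def by auto
      qed
      show "restrict ?e X w = b w" if w: "w \<in> V" for w
      proof -
        have "w \<in> X" "w \<notin> W \<Gamma>\<^sub>0" "w \<noteq> v" using w V v nW[of w] by auto
        then show ?thesis using e0(2)[OF w] by simp
      qed
      show "restrict ?e X v = e\<^sub>1 v" using eX[OF v(1)] nW[of v] by simp
      show "realizes U (restrict ?e X) \<Gamma>\<^sub>0"
        unfolding realizes_def
      proof
        fix \<gamma> assume \<gamma>: "\<gamma> \<in> \<Gamma>\<^sub>0"
        have "sat U (restrict ?e X) \<gamma> \<longleftrightarrow> sat U (override_on e' b V) \<gamma>"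
        proof (rule sat_cong)
          fix w assume w: "w \<in> fv \<gamma>"
          then have wX: "w \<in> X" using \<gamma> sub \<Gamma> unfolding fms_def by blast
          have "w \<in> V \<or> w = v \<or> w \<in> W \<Gamma>\<^sub>0" using w \<gamma> unfolding W_def by blast
          then consider "w \<in> V" "w \<notin> W \<Gamma>\<^sub>0" "w \<noteq> v" | "w = v" "w \<notin> W \<Gamma>\<^sub>0" "w \<notin> V"
            | "w \<in> W \<Gamma>\<^sub>0" "w \<notin> V" using v(2) unfolding W_def by blast
          then show "restrict ?e X w = override_on e' b V w"
          proof cases
            case 1
            then show ?thesis unfolding eX[OF wX] override_on_def using e0(2) by simp
          next
            case 2
            then show ?thesis unfolding eX[OF wX] override_on_def using e'(2)[of w] by simp
          next
            case 3
            then show ?thesis unfolding eX[OF wX] override_on_def by simp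
          qed
        qed
        then show "sat U (restrict ?e X) \<gamma>" using e'(3)[OF \<gamma>] by blast
      qed
    qed
  qed
qed

text \<open>Values are fixed along an enumeration of \<open>X\<close>, finitely many at each stage.
  A formula has finitely many free variables, so its truth is settled at some finite stage.\<close>

lemma saturated_realizes:
  assumes "saturated L U" "infinite (universe L U)" "A \<subseteq> universe L U" "A \<prec> universe L U"
    and X: "X \<subseteq> UNIV \<times> sorts L" "countable X"
    and \<Gamma>: "\<Gamma> \<subseteq> fms L A X" "consistent L U X \<Gamma>"
  shows "\<exists>e\<in>tup (universe L U) X. realizes U e \<Gamma>"
proof -
  let ?i = "to_nat_on X"
  have inj: "inj_on ?i X" using X(2) by (rule inj_on_to_nat_on)
  define V where "V n = {w\<in>X. ?i w < n}" for n
  have finV: "finite (V n)" for n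
  proof (rule finite_imageD)
    show "finite (?i ` V n)" by (rule finite_subset[of _ "{..<n}"]) (auto simp: V_def)
    show "inj_on ?i (V n)" by (rule inj_on_subset[OF inj]) (auto simp: V_def)
  qed
  let ?P = "\<lambda>n b. \<forall>\<Gamma>\<^sub>0. finite \<Gamma>\<^sub>0 \<and> \<Gamma>\<^sub>0 \<subseteq> \<Gamma> \<longrightarrow>
    (\<exists>e\<in>tup (universe L U) X. realizes U e \<Gamma>\<^sub>0 \<and> (\<forall>w\<in>V n. e w = b w))"
  have "\<exists>b. \<forall>n. ?P n (b n) \<and> (\<forall>w\<in>V n. b (Suc n) w = b n w)"
  proof (rule dependent_nat_choice)
    show "\<exists>b. ?P 0 b" using \<Gamma>(2) unfolding consistent_def V_def by auto
    fix b n assume P: "?P n b"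
    show "\<exists>b'. ?P (Suc n) b' \<and> (\<forall>w\<in>V n. b' w = b w)"
    \<comment> \<open>\<open>X\<close> may be finite, and then large indices belong to no
      variable.\<close>
    proof (cases "\<exists>v\<in>X. ?i v = n")
      case False
      then have "V (Suc n) = V n" unfolding V_def by (auto simp: less_Suc_eq)
      then show ?thesis using P by (intro exI[of _ b]) simp
    next
      case True
      then obtain v where v: "v \<in> X" "?i v = n" by blast
      have VS: "V (Suc n) = insert v (V n)"
      proof (rule set_eqI)
        fix w
        have "w = v" if "w \<in> X" "?i w = n" using inj_onD[OF inj, of w v] that v by simp
        then show "w \<in> V (Suc n) \<longleftrightarrow> w \<in> insert v (V n)"
          using v unfolding V_def mem_Collect_eq insert_iff less_Suc_eq by blast
      qed
      have nv: "v \<notin> V n" using v unfolding V_def by simp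
      have "\<exists>c. \<forall>\<Gamma>\<^sub>0. finite \<Gamma>\<^sub>0 \<and> \<Gamma>\<^sub>0 \<subseteq> \<Gamma> \<longrightarrow>
        (\<exists>e\<in>tup (universe L U) X. realizes U e \<Gamma>\<^sub>0 \<and> (\<forall>w\<in>V n. e w = b w) \<and> e v = c)"
      proof (rule realizes_next)
        show "V n \<subseteq> X" unfolding V_def by blast
        show "\<exists>e\<in>tup (universe L U) X. realizes U e \<Gamma>\<^sub>0 \<and> (\<forall>w\<in>V n. e w = b w)"
          if "finite \<Gamma>\<^sub>0" "\<Gamma>\<^sub>0 \<subseteq> \<Gamma>" for \<Gamma>\<^sub>0 using P that by blast
      qed (fact assms v nv finV)+
      then obtain c where c: "\<forall>\<Gamma>\<^sub>0. finite \<Gamma>\<^sub>0 \<and> \<Gamma>\<^sub>0 \<subseteq> \<Gamma> \<longrightarrow>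
        (\<exists>e\<in>tup (universe L U) X. realizes U e \<Gamma>\<^sub>0 \<and> (\<forall>w\<in>V n. e w = b w) \<and> e v = c)" ..
      have "(\<forall>w\<in>V (Suc n). e w = (b(v := c)) w) \<longleftrightarrow> (\<forall>w\<in>V n. e w = b w) \<and> e v = c" for e
        using nv unfolding VS by (metis fun_upd_apply insert_iff)
      with c have "?P (Suc n) (b(v := c))" by simp
      moreover have "\<forall>w\<in>V n. (b(v := c)) w = b w" using nv by auto
      ultimately show ?thesis by blast
    qed
  qed
  then obtain b where b: "\<forall>n. ?P n (b n) \<and> (\<forall>w\<in>V n. b (Suc n) w = b n w)" ..
  have P: "?P n (b n)" for n
    using spec[OF b, of n] by (rule conjunct1)
  have next_eq: "b (Suc n) w = b n w" if "w \<in> V n" for n w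
    using spec[OF b, of n, THEN conjunct2] that by (rule bspec)
  have stable: "b m w = b n w" if "w \<in> V n" "n \<le> m" for w n m
    using that(2)
  proof (induction rule: dec_induct)
    case (step m)
    then have "w \<in> V m" using that unfolding V_def by simp
    from next_eq[OF this] step.IH show ?case by (rule trans)
  qed simp
  \<comment> \<open>The value of \<open>w\<close> is chosen on passing to stage
    \<open>Suc (?i w)\<close>, the first with \<open>w\<close> in \<open>V\<close>, and never
    changes afterwards.\<close>
  define e where "e = restrict (\<lambda>w. b (Suc (?i w)) w) X"
  have e: "e w = b n w" if "w \<in> V n" for w n
    using that stable[of w "Suc (?i w)" n] unfolding e_def V_def by auto
  show ?thesis
  proof
    show "e \<in> tup (universe L U) X"
      unfolding e_def
    proof (rule tupI)
      fix w assume w: "w \<in> X"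
      obtain e' where "e' \<in> tup (universe L U) X" "\<forall>u\<in>V (Suc (?i w)). e' u = b (Suc (?i w)) u"
        using P[of "Suc (?i w)", rule_format, of "{}"] by auto
      then show "(snd w, b (Suc (?i w)) w) \<in> universe L U"
        using tupD[of e' _ X w] w unfolding V_def by (metis (mono_tags, lifting) lessI mem_Collect_eq)
    qed
    show "realizes U e \<Gamma>"
      unfolding realizes_def
    proof
      fix \<gamma> assume \<gamma>: "\<gamma> \<in> \<Gamma>"
      define n where "n = Suc (Max (insert 0 (?i ` fv \<gamma>)))"
      have fvV: "w \<in> V n" if "w \<in> fv \<gamma>" for w
      proof -
        have "?i w \<le> Max (insert 0 (?i ` fv \<gamma>))" using that finite_fv[of \<gamma>] by (intro Max_ge) auto
        moreover have "w \<in> X" using that \<gamma> \<Gamma>(1) unfolding fms_def by blast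
        ultimately show ?thesis unfolding V_def n_def by simp
      qed
      obtain e' where e': "realizes U e' {\<gamma>}" "\<forall>w\<in>V n. e' w = b n w"
        using P[of n, rule_format, of "{\<gamma>}"] \<gamma> by auto
      have "sat U e \<gamma> \<longleftrightarrow> sat U e' \<gamma>"
        by (rule sat_cong) (use e' fvV e in metis)
      then show "sat U e \<gamma>" using e'(1) unfolding realizes_def by simp
    qed
  qed
qed

section \<open>Extending a t-compressible type by one formula\<close>

text \<open>For a fixed truth pattern \<open>t\<close>, all conjunctions of an instance of \<zeta>
  with \<open>length t\<close> signed instances of \<phi> are instances of one formula, provided
  that each copy of \<phi> has its own parameter variables.\<close>

lemma literal_template:
  fixes \<zeta> \<phi> :: "('s, 'f, 'r, 'u) fm" and L :: "('s, 'f, 'r) lang"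
  assumes X: "var_tuple L X" and \<zeta>: "lfm L \<zeta>" and \<phi>: "lfm L \<phi>"
  shows "\<exists>\<zeta>'. lfm L \<zeta>' \<and> (\<forall>c ys. c \<in> tup A (pvars X \<zeta>) \<and> set ys \<subseteq> tup A (pvars X \<phi>) \<and>
    length ys = length t \<longrightarrow> (\<exists>a\<in>tup A (pvars X \<zeta>'). \<forall>e. sat U e (inst (pvars X \<zeta>') a \<zeta>') \<longleftrightarrow>
      sat U e (inst (pvars X \<zeta>) c \<zeta>) \<and>
      (\<forall>i<length t. sat U e (inst (pvars X \<phi>) (ys ! i) \<phi>) = t ! i)))"
proof -
  let ?V = "pvars X \<phi>" and ?Z = "pvars X \<zeta>"
  let ?Q = "{..<length t} \<times> ?V"
  have wf: "wf_fm L \<phi>" "wf_fm L \<zeta>" and par: "params \<phi> = {}" "params \<zeta> = {}"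
    using \<zeta> \<phi> unfolding lfm_def by auto
  \<comment> \<open>\<open>\<rho> (i, v)\<close> is the copy of \<open>v\<close> in the
    \<open>i\<close>-th literal. Injectivity separates the copies; avoiding \<open>X\<close> makes
    it a parameter variable, avoiding \<open>?Z\<close> keeps it apart from those of \<zeta>, and
    avoiding \<open>bv \<phi>\<close> prevents capture.\<close>
  have "\<exists>\<rho>. inj_on \<rho> ?Q \<and> (\<forall>q\<in>?Q. snd (\<rho> q) = snd (snd q) \<and> \<rho> q \<notin> X \<union> (?Z \<union> bv \<phi>))"
  proof (rule fresh_variables[OF _ _ _ X])
    show "finite ?Q" "finite (?Z \<union> bv \<phi>)"
      using finite_fv[of \<phi>] finite_fv[of \<zeta>] finite_bv[of \<phi>] unfolding pvars_def by auto
    show "snd (snd q) \<in> sorts L" if "q \<in> ?Q" for q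
    proof -
      have "snd q \<in> fv \<phi>" using that unfolding pvars_def by auto
      then show ?thesis by (rule fv_sorts[OF wf(1)])
    qed
  qed
  then obtain \<rho> where inj: "inj_on \<rho> ?Q" and \<rho>: "\<And>i v. i < length t \<Longrightarrow> v \<in> ?V \<Longrightarrow>
      snd (\<rho> (i, v)) = snd v \<and> \<rho> (i, v) \<notin> X \<and> \<rho> (i, v) \<notin> ?Z \<and> \<rho> (i, v) \<notin> bv \<phi>" by fastforce
  let ?B = "fv \<phi> \<inter> X"
  have fvB: "fv \<phi> - ?B = ?V" unfolding pvars_def by blast
  define \<chi> where "\<chi> i = rename ?B (\<lambda>v. \<rho> (i, v)) undefined \<phi>" for i
  define lit where "lit i = (if t ! i then \<chi> i else Neg (\<chi> i))" for i
  define \<zeta>' where "\<zeta>' = Conj \<zeta> (bigconj (map lit [0..<length t]))"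
  have wf\<chi>: "wf_fm L (\<chi> i)" if "i < length t" for i
    unfolding \<chi>_def by (rule wf_rename[OF wf(1)]) (use \<rho>[OF that] par fvB in auto)
  have fv\<chi>: "fv (\<chi> i) \<subseteq> X \<union> \<rho> ` ?Q" if "i < length t" for i
  proof -
    have "fv (\<chi> i) \<subseteq> ?B \<union> (\<lambda>v. \<rho> (i, v)) ` ?V"
      using fv_rename[of ?B "\<lambda>v. \<rho> (i, v)" undefined \<phi>] unfolding \<chi>_def fvB par(1) by simp
    moreover have "(\<lambda>v. \<rho> (i, v)) ` ?V \<subseteq> \<rho> ` ?Q" using that by auto
    ultimately show ?thesis by blast
  qed
  have lfm: "lfm L \<zeta>'"
    unfolding lfm_def
  proof
    show "wf_fm L \<zeta>'" using wf(2) wf\<chi> unfolding \<zeta>'_def lit_def by (auto simp: wf_bigconj)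
    have "params (lit i) = {}" for i unfolding lit_def \<chi>_def by (simp add: params_rename)
    then show "params \<zeta>' = {}" unfolding \<zeta>'_def by (simp add: params_bigconj par(2))
  qed
  have "fv \<zeta>' \<subseteq> X \<union> ?Z \<union> \<rho> ` ?Q"
  proof -
    have "fv (lit i) \<subseteq> X \<union> \<rho> ` ?Q" if "i < length t" for i
      using fv\<chi>[OF that] unfolding lit_def by simp
    then have "fv (bigconj (map lit [0..<length t])) \<subseteq> X \<union> \<rho> ` ?Q"
      unfolding fv_bigconj by fastforce
    then show ?thesis unfolding \<zeta>'_def pvars_def fv.simps by blast
  qed
  then have pv: "pvars X \<zeta>' \<subseteq> ?Z \<union> \<rho> ` ?Q" unfolding pvars_def[of X \<zeta>'] by blast
  show ?thesis
  proof (intro exI[of _ \<zeta>'] conjI lfm allI impI)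
    fix c ys assume "c \<in> tup A ?Z \<and> set ys \<subseteq> tup A ?V \<and> length ys = length t"
    then have c: "c \<in> tup A ?Z" and ys: "set ys \<subseteq> tup A ?V" "length ys = length t" by auto
    define a where "a v = (if v \<in> ?Z then c v else
      case inv_into ?Q \<rho> v of (i, w) \<Rightarrow> (ys ! i) w)" for v
    have aZ: "a v = c v" if "v \<in> ?Z" for v using that unfolding a_def by simp
    have aQ: "a (\<rho> (i, w)) = (ys ! i) w" if "i < length t" "w \<in> ?V" for i w
      using \<rho>[OF that] inv_into_f_f[OF inj, of "(i, w)"] that unfolding a_def by simp
    let ?a = "restrict a (pvars X \<zeta>')"
    show "\<exists>a\<in>tup A (pvars X \<zeta>'). \<forall>e. sat U e (inst (pvars X \<zeta>') a \<zeta>') \<longleftrightarrow>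
      sat U e (inst ?Z c \<zeta>) \<and> (\<forall>i<length t. sat U e (inst ?V (ys ! i) \<phi>) = t ! i)"
    proof (intro bexI allI)
      show "?a \<in> tup A (pvars X \<zeta>')"
      proof (rule tupI)
        fix v assume "v \<in> pvars X \<zeta>'"
        with pv consider "v \<in> ?Z" | i w where "i < length t" "w \<in> ?V" "v = \<rho> (i, w)" by blast
        then show "(snd v, a v) \<in> A"
        proof cases
          case 1
          then show ?thesis using tupD[OF c] aZ by simp
        next
          case 2
          have "ys ! i \<in> tup A ?V" using ys 2(1) by auto
          then show ?thesis using tupD[of "ys ! i" A ?V w] \<rho>[OF 2(1,2)] aQ[OF 2(1,2)] 2 by simp
        qed
      qed
      fix e
      let ?e = "override_on e a (?Z \<union> \<rho> ` ?Q)"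
      have eX: "?e v = e v" if "v \<in> X" for v
      proof -
        have "v \<notin> ?Z" using that unfolding pvars_def by blast
        moreover have "v \<notin> \<rho> ` ?Q" using \<rho> that by blast
        ultimately show ?thesis by (simp add: override_on_def)
      qed
      have "sat U e (inst (pvars X \<zeta>') ?a \<zeta>') \<longleftrightarrow> sat U ?e \<zeta>'"
        unfolding sat_inst
      proof (rule sat_cong)
        fix v assume v: "v \<in> fv \<zeta>'"
        show "override_on e ?a (pvars X \<zeta>') v = ?e v"
        proof (cases "v \<in> X")
          case True
          then show ?thesis using eX[OF True] by (simp add: override_on_def pvars_def)
        next
          case False
          then have "v \<in> pvars X \<zeta>'" using v unfolding pvars_def by blast
          then show ?thesis using pv by (auto simp: override_on_def)
        qed
      qed
      also have "\<dots> \<longleftrightarrow> sat U ?e \<zeta> \<and> (\<forall>i<length t. sat U ?e (\<chi> i) = t ! i)"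
      proof -
        have "sat U ?e (lit i) \<longleftrightarrow> sat U ?e (\<chi> i) = t ! i" for i unfolding lit_def by simp
        then show ?thesis unfolding \<zeta>'_def by (auto simp: sat_bigconj)
      qed
      also have "sat U ?e \<zeta> \<longleftrightarrow> sat U e (inst ?Z c \<zeta>)"
        unfolding sat_inst
      proof (rule sat_cong)
        fix v assume v: "v \<in> fv \<zeta>"
        show "?e v = override_on e c ?Z v"
        proof (cases "v \<in> X")
          case True
          then show ?thesis using eX[OF True] by (simp add: override_on_def pvars_def)
        next
          case False
          then have "v \<in> ?Z" using v unfolding pvars_def by blast
          then show ?thesis using aZ by (simp add: override_on_def)
        qed
      qed
      also have "(\<forall>i<length t. sat U ?e (\<chi> i) = t ! i) \<longleftrightarrow>
        (\<forall>i<length t. sat U e (inst ?V (ys ! i) \<phi>) = t ! i)"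
      proof -
        have "sat U ?e (\<chi> i) = sat U e (inst ?V (ys ! i) \<phi>)" if i: "i < length t" for i
        proof -
          have "sat U ?e (\<chi> i) = sat U (\<lambda>v. if v \<in> ?B then ?e v else ?e (\<rho> (i, v))) \<phi>"
            unfolding \<chi>_def by (rule sat_rename) (use \<rho>[OF i] fvB par in auto)
          also have "\<dots> = sat U e (inst ?V (ys ! i) \<phi>)"
            unfolding sat_inst
          proof (rule sat_cong)
            fix v assume v: "v \<in> fv \<phi>"
            show "(if v \<in> ?B then ?e v else ?e (\<rho> (i, v))) = override_on e (ys ! i) ?V v"
            proof (cases "v \<in> X")
              case True
              then show ?thesis using v eX[OF True] by (simp add: override_on_def pvars_def)
            next
              case False
              then have vV: "v \<in> ?V" using v unfolding pvars_def by blast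
              then have "\<rho> (i, v) \<in> \<rho> ` ?Q" using i by blast
              then have "?e (\<rho> (i, v)) = (ys ! i) v" using aQ[OF i vV] by (simp add: override_on_def)
              then show ?thesis using False vV by (simp add: override_on_def)
            qed
          qed
          finally show ?thesis .
        qed
        then show ?thesis by simp
      qed
      finally show "sat U e (inst (pvars X \<zeta>') ?a \<zeta>') \<longleftrightarrow>
        sat U e (inst ?Z c \<zeta>) \<and> (\<forall>i<length t. sat U e (inst ?V (ys ! i) \<phi>) = t ! i)" .
    qed
  qed
qed

text \<open>NIP is used for the opposite partition: the sets are \<phi>(e,y) with \<open>e\<close>
  an x-tuple, restricted to the finitely many variables \<open>?W\<close>. If all truth patterns
  occurred on \<open>z\<close>, its entries would be distinct and shattered; the length
  \<open>Suc d\<close> exceeds the dimension bound \<open>d\<close>.\<close>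

lemma NIP_patterns:
  fixes \<phi> :: "('s, 'f, 'r, 'u) fm"
  assumes "NIP L U" "A \<subseteq> universe L U" "X \<subseteq> UNIV \<times> sorts L" and \<phi>: "lfm L \<phi>"
  shows "\<exists>n>0. \<forall>F z. F \<le> principal (tup (universe L U) X) \<longrightarrow> z \<in> lists (tup A (pvars X \<phi>)) \<longrightarrow>
    length z = n \<longrightarrow>
    card (patterns (\<lambda>a e. sat U e (inst (pvars X \<phi>) a \<phi>)) F z) \<le> 2 ^ n - 1"
proof -
  let ?V = "pvars X \<phi>" and ?W = "fv \<phi> \<inter> X"
  let ?R = "\<lambda>a e. sat U e (inst ?V a \<phi>)"
  let ?C = "\<lambda>b. {a \<in> tup (universe L U) ?V. sat U a (inst ?W b \<phi>)}"
  have fvs: "fv \<phi> \<subseteq> UNIV \<times> sorts L"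
    using fv_sorts \<phi> unfolding lfm_def by fastforce
  then have "finite_vc_dim (?C ` tup (universe L U) ?W)"
    using assms(1)[unfolded NIP_def, rule_format, of \<phi> ?V ?W] \<phi> finite_fv[of \<phi>]
    unfolding pvars_def by blast
  then obtain d where d: "\<And>S. finite S \<Longrightarrow> shatters (?C ` tup (universe L U) ?W) S \<Longrightarrow> card S \<le> d"
    unfolding finite_vc_dim_def by blast
  have "card (patterns ?R F z) \<le> 2 ^ Suc d - 1"
    if F: "F \<le> principal (tup (universe L U) X)" and z: "z \<in> lists (tup A ?V)" "length z = Suc d" for F z
  proof (rule ccontr)
    let ?all = "{s :: bool list. length s = length z}"
    assume "\<not> ?thesis"
    moreover have call: "card ?all = 2 ^ Suc d"
      using card_lists_length_eq[of "UNIV :: bool set" "length z"] z(2) by simp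
    moreover have "finite ?all"
      using finite_lists_length_eq[of "UNIV :: bool set" "length z"] by simp
    ultimately have all: "patterns ?R F z = ?all"
      using card_seteq[OF _ patterns_length, of z ?R F] by simp
    have ex: "\<exists>e\<in>tup (universe L U) X. map (\<lambda>a. ?R a e) z = s" if "length s = length z" for s
    proof -
      have "\<exists>\<^sub>F e in F. map (\<lambda>a. ?R a e) z = s" using all that unfolding patterns_def by blast
      moreover have "eventually (\<lambda>e. e \<in> tup (universe L U) X) F"
        using F by (simp add: le_principal)
      ultimately show ?thesis using frequently_eventually_conj frequently_ex by fastforce
    qed
    \<comment> \<open>A repeated entry cannot realise a pattern that differs at its two
      positions.\<close>
    have "distinct z"
      unfolding distinct_conv_nth
    proof (intro allI impI notI)
      fix i j assume ij: "i < length z" "j < length z" "i \<noteq> j" "z ! i = z ! j"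
      obtain e where "map (\<lambda>a. ?R a e) z = (replicate (length z) False)[i := True]"
        using ex[of "(replicate (length z) False)[i := True]"] by auto
      then have "?R (z ! i) e = True" "?R (z ! j) e = False"
        using ij by (metis nth_map nth_list_update_eq length_replicate)
          (metis \<open>map (\<lambda>a. ?R a e) z = (replicate (length z) False)[i := True]\<close> ij nth_map
            nth_list_update_neq nth_replicate)
      then show False using ij by simp
    qed
    moreover have "shatters (?C ` tup (universe L U) ?W) (set z)"
      unfolding shatters_def
    proof (intro allI impI)
      fix B assume B: "B \<subseteq> set z"
      obtain e where e: "e \<in> tup (universe L U) X" "map (\<lambda>a. ?R a e) z = map (\<lambda>a. a \<in> B) z"
        using ex[of "map (\<lambda>a. a \<in> B) z"] by auto
      have R: "?R a e \<longleftrightarrow> a \<in> B" if "a \<in> set z" for a using e(2) that by simp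
      have C: "a \<in> ?C (restrict e ?W) \<longleftrightarrow> a \<in> B" if a: "a \<in> set z" for a
      proof -
        have "a \<in> tup (universe L U) ?V" using a z(1) tup_mono[OF assms(2)] by blast
        moreover have "sat U a (inst ?W (restrict e ?W) \<phi>) \<longleftrightarrow> ?R a e"
          unfolding sat_inst by (rule sat_cong) (auto simp: override_on_def pvars_def)
        ultimately show ?thesis using R[OF a] by simp
      qed
      then have "?C (restrict e ?W) \<inter> set z = B" using B by blast
      moreover have "restrict e ?W \<in> tup (universe L U) ?W" using tupD[OF e(1)] by (intro tupI) blast
      ultimately show "\<exists>C\<in>?C ` tup (universe L U) ?W. C \<inter> set z = B" by blast
    qed
    ultimately show False using d[of "set z"] z(2) distinct_card[of z] by simp
  qed
  then show ?thesis by blast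
qed

section \<open>The filter of a partial type, and extension by one formula\<close>

text \<open>Finite satisfiability alone makes this filter proper, so it can stand in for the
  realisations of \<pi> before any is known to exist.\<close>

definition type_filter ::
    "('s, 'f, 'r) lang \<Rightarrow> ('s, 'f, 'r, 'u) fo_struct \<Rightarrow> 's var set \<Rightarrow> ('s, 'f, 'r, 'u) fm set \<Rightarrow>
     ('s var \<Rightarrow> 'u) filter" where
  "type_filter L U X \<pi> =
     (INF \<pi>\<^sub>0\<in>{\<pi>\<^sub>0. finite \<pi>\<^sub>0 \<and> \<pi>\<^sub>0 \<subseteq> \<pi>}. principal {e\<in>tup (universe L U) X. realizes U e \<pi>\<^sub>0})"

lemma eventually_type_filter:
  "eventually G (type_filter L U X \<pi>) \<longleftrightarrow>
     (\<exists>\<pi>\<^sub>0\<subseteq>\<pi>. finite \<pi>\<^sub>0 \<and> (\<forall>e\<in>tup (universe L U) X. realizes U e \<pi>\<^sub>0 \<longrightarrow> G e))"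
proof -
  have "eventually G (type_filter L U X \<pi>) \<longleftrightarrow> (\<exists>\<pi>\<^sub>0\<in>{\<pi>\<^sub>0. finite \<pi>\<^sub>0 \<and> \<pi>\<^sub>0 \<subseteq> \<pi>}.
    eventually G (principal {e\<in>tup (universe L U) X. realizes U e \<pi>\<^sub>0}))"
    unfolding type_filter_def
  proof (rule eventually_INF_base)
    fix \<pi>\<^sub>1 \<pi>\<^sub>2 assume "\<pi>\<^sub>1 \<in> {\<pi>\<^sub>0. finite \<pi>\<^sub>0 \<and> \<pi>\<^sub>0 \<subseteq> \<pi>}" "\<pi>\<^sub>2 \<in> {\<pi>\<^sub>0. finite \<pi>\<^sub>0 \<and> \<pi>\<^sub>0 \<subseteq> \<pi>}"
    then show "\<exists>\<pi>\<^sub>0\<in>{\<pi>\<^sub>0. finite \<pi>\<^sub>0 \<and> \<pi>\<^sub>0 \<subseteq> \<pi>}. principal {e\<in>tup (universe L U) X. realizes U e \<pi>\<^sub>0} \<le>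
      inf (principal {e\<in>tup (universe L U) X. realizes U e \<pi>\<^sub>1})
        (principal {e\<in>tup (universe L U) X. realizes U e \<pi>\<^sub>2})"
      by (intro bexI[of _ "\<pi>\<^sub>1 \<union> \<pi>\<^sub>2"]) (auto simp: realizes_def)
  qed auto
  then show ?thesis unfolding eventually_principal by blast
qed

lemma type_filter_nonbot: "consistent L U X \<pi> \<Longrightarrow> type_filter L U X \<pi> \<noteq> bot"
  using eventually_type_filter[of "\<lambda>_. False" L U X \<pi>]
  unfolding consistent_def trivial_limit_def by blast

lemma type_filter_le: "type_filter L U X \<pi> \<le> principal (tup (universe L U) X)"
  unfolding le_principal eventually_type_filter by blast

text \<open>\<open>q\<close> consists of the literals belonging to a deciding filter. Over a finite
  \<open>A\<^sub>0\<close>, at most \<open>k\<close> of these literals imply the rest modulo a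
  finite part of \<pi>, and an instance of \<zeta> implies both that part and the formulas of \<pi>
  over \<open>A\<^sub>0\<close>. The conjunction compresses, up to the dependence of the truth
  pattern on \<open>A\<^sub>0\<close>.\<close>

lemma t_compressible_extend:
  fixes \<phi> :: "('s, 'f, 'r, 'u) fm" and L :: "('s, 'f, 'r) lang"
  assumes "NIP L U" "A \<subseteq> universe L U" and X: "var_tuple L X"
    and \<pi>: "partial_type L U A X \<pi>" "t_compressible L U A X \<pi>" and \<phi>: "lfm L \<phi>"
  shows "\<exists>q. (\<forall>\<psi>\<in>q. \<exists>a\<in>tup A (pvars X \<phi>). \<psi> = inst (pvars X \<phi>) a \<phi> \<or> \<psi> = Neg (inst (pvars X \<phi>) a \<phi>)) \<and>
    (\<forall>a\<in>tup A (pvars X \<phi>). inst (pvars X \<phi>) a \<phi> \<in> q \<or> Neg (inst (pvars X \<phi>) a \<phi>) \<in> q) \<and>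
    partial_type L U A X (\<pi> \<union> q) \<and> t_compressible L U A X (\<pi> \<union> q)"
proof -
  let ?V = "pvars X \<phi>"
  let ?I = "tup A ?V" and ?E = "tup (universe L U) X"
  define R where "R a e = sat U e (inst ?V a \<phi>)" for a e
  let ?F\<^sub>0 = "type_filter L U X \<pi>"
  have \<pi>f: "\<pi> \<subseteq> fms L A X" and con: "consistent L U X \<pi>" using \<pi>(1) unfolding partial_type_def by auto
  have XS: "X \<subseteq> UNIV \<times> sorts L" using X unfolding var_tuple_def by blast
  obtain n where n: "n > 0" "\<And>F z. F \<le> principal ?E \<Longrightarrow> z \<in> lists ?I \<Longrightarrow> length z = n \<Longrightarrow>
      card (patterns R F z) \<le> 2 ^ n - 1"
    using NIP_patterns[OF assms(1,2) XS \<phi>] unfolding R_def by blast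
  have "\<exists>k F. compressed R ?I k F ?F\<^sub>0 \<and> (\<forall>a\<in>?I. eventually (R a) F \<or> eventually (\<lambda>e. \<not> R a e) F)"
  proof (rule compressed_deciding_exists)
    show "?F\<^sub>0 \<noteq> bot" by (rule type_filter_nonbot[OF con])
    show "card (patterns R ?F\<^sub>0 z) \<le> 2 ^ n - 1" if "z \<in> lists ?I" "length z = n" for z
      by (rule n(2)[OF type_filter_le that])
  qed (use n(1) in auto)
  then obtain k F where F: "compressed R ?I k F ?F\<^sub>0"
    and dec: "\<And>a. a \<in> ?I \<Longrightarrow> eventually (R a) F \<or> eventually (\<lambda>e. \<not> R a e) F" by blast
  have le: "F \<le> ?F\<^sub>0" and bot: "F \<noteq> bot" using compressed_le[OF F] compressed_nonbot[OF F] by auto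
  define d where "d a = eventually (R a) F" for a
  have d: "eventually (\<lambda>e. R a e = d a) F" if "a \<in> ?I" for a
    using dec[OF that] unfolding d_def by (cases "eventually (R a) F") auto
  define lit where "lit a = (if d a then inst ?V a \<phi> else Neg (inst ?V a \<phi>))" for a
  define q where "q = lit ` ?I"
  have sat_lit: "sat U e (lit a) \<longleftrightarrow> R a e = d a" for a e unfolding lit_def R_def by simp
  have VS: "(snd v, a v) \<in> A" if "a \<in> ?I" "v \<in> ?V" for a v using tupD[OF that] .
  have par\<phi>: "params \<phi> = {}" and wf\<phi>: "wf_fm L \<phi>" using \<phi> unfolding lfm_def by auto
  \<comment> \<open>All of \<open>?V\<close> is free in \<phi>, so the parameters of a literal are
    exactly the entries of \<open>a\<close>: a literal over \<open>A\<^sub>0\<close> comes from a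
    tuple of \<open>A\<^sub>0\<close>.\<close>
  have par_lit: "params (lit a) = (\<lambda>v. (snd v, a v)) ` ?V" for a
    unfolding lit_def by (auto simp: params_inst par\<phi> pvars_def)
  have "inst ?V a \<phi> \<in> fms L A X" if "a \<in> ?I" for a
    by (rule inst_fms) (use wf\<phi> par\<phi> VS[OF that] in \<open>auto simp: pvars_def\<close>)
  then have "lit a \<in> fms L A X" if "a \<in> ?I" for a using that by (simp add: lit_def fms_def)
  then have qf: "q \<subseteq> fms L A X" unfolding q_def by blast
  have evF: "eventually (\<lambda>e. sat U e \<psi>) F" if "\<psi> \<in> \<pi> \<union> q" for \<psi>
  proof (cases "\<psi> \<in> \<pi>")
    case True
    have "eventually (\<lambda>e. sat U e \<psi>) ?F\<^sub>0"
      unfolding eventually_type_filter using True by (intro exI[of _ "{\<psi>}"]) (auto simp: realizes_def)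
    then show ?thesis using le by (rule filter_leD[rotated])
  next
    case False
    then show ?thesis using that d unfolding q_def by (auto simp: sat_lit)
  qed
  have "partial_type L U A X (\<pi> \<union> q)"
    unfolding partial_type_def consistent_def
  proof (intro conjI allI impI)
    show "\<pi> \<union> q \<subseteq> fms L A X" using \<pi>f qf by blast
    fix \<Gamma> assume \<Gamma>: "\<Gamma> \<subseteq> \<pi> \<union> q" "finite \<Gamma>"
    have "eventually (\<lambda>e. \<forall>\<psi>\<in>\<Gamma>. sat U e \<psi>) F" using \<Gamma> evF by (intro eventually_ball_finite) auto
    moreover have "eventually (\<lambda>e. e \<in> ?E) F"
      using order_trans[OF le type_filter_le] unfolding le_principal .
    ultimately have "eventually (\<lambda>e. e \<in> ?E \<and> realizes U e \<Gamma>) F"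
      by eventually_elim (simp add: realizes_def)
    then show "\<exists>e\<in>?E. realizes U e \<Gamma>" using bot eventually_happens by blast
  qed
  moreover have "t_compressible L U A X (\<pi> \<union> q)"
  proof -
    obtain \<zeta> where \<zeta>: "lfm L \<zeta>" "compresses L U A X \<zeta> \<pi> \<pi>"
      using \<pi>(2) unfolding t_compressible_def compressible_within_def by blast
    let ?Z = "pvars X \<zeta>"
    define ok where "ok A\<^sub>0 \<longleftrightarrow> finite A\<^sub>0 \<and> A\<^sub>0 \<subseteq> A" for A\<^sub>0
    define work where "work t A\<^sub>0 \<longleftrightarrow> (\<exists>c ys. c \<in> tup A ?Z \<and> set ys \<subseteq> ?I \<and> length ys = length t \<and>
        implies_in L U X \<pi> {inst ?Z c \<zeta>} \<and> (\<forall>i<length t. d (ys ! i) = t ! i) \<and>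
        (\<forall>e\<in>?E. sat U e (inst ?Z c \<zeta>) \<and> (\<forall>i<length t. R (ys ! i) e = t ! i) \<longrightarrow>
           realizes U e (restr_params A\<^sub>0 (\<pi> \<union> q))))" for t A\<^sub>0
    have ex: "\<exists>t. length t \<le> k \<and> work t A\<^sub>0" if ok: "ok A\<^sub>0" for A\<^sub>0
    proof -
      have A0: "finite A\<^sub>0" "A\<^sub>0 \<subseteq> A" using ok unfolding ok_def by auto
      have fin: "finite (tup A\<^sub>0 ?V)"
        unfolding tup_def
      proof (rule finite_PiE)
        show "finite ?V" using finite_fv unfolding pvars_def by blast
        show "finite {a. (snd v, a) \<in> A\<^sub>0}" for v
          by (rule finite_subset[of _ "snd ` A\<^sub>0"]) (use A0 in force)+
      qed
      have I0: "tup A\<^sub>0 ?V \<subseteq> ?I" using A0(2) by (rule tup_mono)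
      have "eventually (\<lambda>e. \<forall>a\<in>tup A\<^sub>0 ?V. R a e = d a) F"
        using fin d I0 by (intro eventually_ball_finite) auto
      with F obtain Y b where Y: "finite Y" "Y \<subseteq> ?I" "card Y \<le> k" "eventually (agree R Y b) F"
        and "eventually (\<lambda>e. agree R Y b e \<longrightarrow> (\<forall>a\<in>tup A\<^sub>0 ?V. R a e = d a)) ?F\<^sub>0"
        by (rule compressedD)
      then obtain \<pi>\<^sub>0 where \<pi>0: "\<pi>\<^sub>0 \<subseteq> \<pi>" "finite \<pi>\<^sub>0" "\<And>e. e \<in> ?E \<Longrightarrow> realizes U e \<pi>\<^sub>0 \<Longrightarrow>
          agree R Y b e \<Longrightarrow> (\<forall>a\<in>tup A\<^sub>0 ?V. R a e = d a)"
        unfolding eventually_type_filter by blast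
      \<comment> \<open>Adding the parameters of \<open>\<pi>\<^sub>0\<close> makes one instance of
        \<zeta> imply also the finite part of \<pi> modulo which the condition decides.\<close>
      let ?A = "A\<^sub>0 \<union> (\<Union>\<psi>\<in>\<pi>\<^sub>0. params \<psi>)"
      have "finite ?A" "?A \<subseteq> A" using A0 \<pi>0(1,2) \<pi>f finite_params unfolding fms_def by blast+
      then obtain c where c: "c \<in> tup A ?Z" "implies_in L U X \<pi> {inst ?Z c \<zeta>}"
        "implies_in L U X {inst ?Z c \<zeta>} (restr_params ?A \<pi>)"
        using \<zeta>(2) unfolding compresses_def by blast
      obtain ys where ys: "set ys = Y" "distinct ys" using finite_distinct_list[OF Y(1)] by blast
      \<comment> \<open>The condition and the decided values both belong to the proper filter
        \<open>F\<close>, so they agree: the literals used are in \<open>q\<close>.\<close>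
      have bd: "b a = d a" if "a \<in> Y" for a
      proof -
        have "eventually (\<lambda>e. b a = d a) F"
          using Y(4) d[of a] by (rule eventually_elim2) (use that Y(2) in \<open>auto simp: agree_def\<close>)
        then show ?thesis using bot by simp
      qed
      let ?t = "map d ys"
      have "work ?t A\<^sub>0"
        unfolding work_def
      proof (intro exI conjI ballI impI)
        show "c \<in> tup A ?Z" "implies_in L U X \<pi> {inst ?Z c \<zeta>}" by fact+
        show "set ys \<subseteq> ?I" "length ys = length ?t" using ys Y by auto
        show "\<forall>i<length ?t. d (ys ! i) = ?t ! i" by simp
        fix e assume e: "e \<in> ?E" "sat U e (inst ?Z c \<zeta>) \<and> (\<forall>i<length ?t. R (ys ! i) e = ?t ! i)"
        have r\<pi>: "realizes U e (restr_params ?A \<pi>)"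
          using c(3) e unfolding implies_in_def realizes_def by blast
        then have "realizes U e \<pi>\<^sub>0" using \<pi>0(1) unfolding realizes_def restr_params_def by blast
        moreover have "agree R Y b e"
          unfolding agree_def
        proof
          fix a assume a: "a \<in> Y"
          then obtain i where "i < length ys" "a = ys ! i" using ys by (metis in_set_conv_nth)
          then show "R a e = b a" using e(2) bd[OF a] by simp
        qed
        ultimately have Rd: "R a e = d a" if "a \<in> tup A\<^sub>0 ?V" for a using \<pi>0(3)[OF e(1)] that by blast
        show "realizes U e (restr_params A\<^sub>0 (\<pi> \<union> q))"
          unfolding realizes_def
        proof
          fix \<psi> assume "\<psi> \<in> restr_params A\<^sub>0 (\<pi> \<union> q)"
          then have \<psi>: "\<psi> \<in> \<pi> \<or> \<psi> \<in> q" "params \<psi> \<subseteq> A\<^sub>0" unfolding restr_params_def by auto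
          from \<psi>(1) show "sat U e \<psi>"
          proof
            assume "\<psi> \<in> \<pi>"
            then show ?thesis using r\<pi> \<psi>(2) unfolding realizes_def restr_params_def by blast
          next
            assume "\<psi> \<in> q"
            then obtain a where a: "a \<in> ?I" "\<psi> = lit a" unfolding q_def by blast
            have "restrict a ?V \<in> tup A\<^sub>0 ?V"
              using \<psi>(2) unfolding a(2) par_lit by (intro tupI) blast
            moreover have "restrict a ?V = a" using a(1) unfolding tup_def by (rule PiE_restrict)
            ultimately show ?thesis unfolding a(2) sat_lit using Rd by simp
          qed
        qed
      qed
      moreover have "length ?t \<le> k" using Y(3) ys distinct_card by fastforce
      ultimately show ?thesis by blast
    qed
    \<comment> \<open>One truth pattern works for cofinally many finite subsets of \<open>A\<close>.
      This suffices, since whatever implies the part over \<open>A'\<close> implies the part over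
      any smaller set.\<close>
    have "\<exists>t\<in>{t. length t \<le> k}. \<forall>A\<^sub>0. ok A\<^sub>0 \<longrightarrow> (\<exists>A'. ok A' \<and> A\<^sub>0 \<subseteq> A' \<and> work t A')"
    proof (rule directed_pigeonhole)
      fix f assume f: "\<And>t :: bool list. t \<in> {t. length t \<le> k} \<Longrightarrow> ok (f t)"
      have "finite {t :: bool list. length t \<le> k}"
        using finite_lists_length_le[of "UNIV :: bool set" k] by simp
      then have ok: "ok (\<Union>(f ` {t. length t \<le> k}))" using f unfolding ok_def by blast
      then show "\<exists>a t. ok a \<and> (\<forall>t\<in>{t. length t \<le> k}. f t \<subseteq> a) \<and> t \<in> {t. length t \<le> k} \<and> work t a"
        using ex[OF ok] by blast
    qed
    then obtain t where t: "\<And>A\<^sub>0. ok A\<^sub>0 \<Longrightarrow> \<exists>A'. ok A' \<and> A\<^sub>0 \<subseteq> A' \<and> work t A'" by blast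
    obtain \<zeta>' where \<zeta>': "lfm L \<zeta>'" and inst: "\<And>c ys. c \<in> tup A ?Z \<Longrightarrow> set ys \<subseteq> ?I \<Longrightarrow>
        length ys = length t \<Longrightarrow> \<exists>a\<in>tup A (pvars X \<zeta>'). \<forall>e. sat U e (inst (pvars X \<zeta>') a \<zeta>') \<longleftrightarrow>
          sat U e (inst ?Z c \<zeta>) \<and> (\<forall>i<length t. R (ys ! i) e = t ! i)"
      using literal_template[OF X \<zeta>(1) \<phi>, of A t U] unfolding R_def by blast
    have "compresses L U A X \<zeta>' (\<pi> \<union> q) (\<pi> \<union> q)"
      unfolding compresses_def
    proof (intro allI impI)
      fix A\<^sub>0 assume "finite A\<^sub>0 \<and> A\<^sub>0 \<subseteq> A"
      then obtain A' where A': "A\<^sub>0 \<subseteq> A'" "work t A'" using t[of A\<^sub>0] unfolding ok_def by blast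
      then obtain c ys where w: "c \<in> tup A ?Z" "set ys \<subseteq> ?I" "length ys = length t"
        "implies_in L U X \<pi> {inst ?Z c \<zeta>}" "\<And>i. i < length t \<Longrightarrow> d (ys ! i) = t ! i"
        and imp: "\<And>e. e \<in> ?E \<Longrightarrow> sat U e (inst ?Z c \<zeta>) \<Longrightarrow> (\<forall>i<length t. R (ys ! i) e = t ! i) \<Longrightarrow>
           realizes U e (restr_params A' (\<pi> \<union> q))"
        unfolding work_def by blast
      obtain a where a: "a \<in> tup A (pvars X \<zeta>')" "\<And>e. sat U e (inst (pvars X \<zeta>') a \<zeta>') \<longleftrightarrow>
          sat U e (inst ?Z c \<zeta>) \<and> (\<forall>i<length t. R (ys ! i) e = t ! i)"
        using inst[OF w(1-3)] by blast
      show "\<exists>a\<in>tup A (pvars X \<zeta>'). implies_in L U X (\<pi> \<union> q) {inst (pvars X \<zeta>') a \<zeta>'} \<and>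
           implies_in L U X {inst (pvars X \<zeta>') a \<zeta>'} (restr_params A\<^sub>0 (\<pi> \<union> q))"
      proof (intro bexI[OF _ a(1)] conjI)
        show "implies_in L U X (\<pi> \<union> q) {inst (pvars X \<zeta>') a \<zeta>'}"
          unfolding implies_in_def
        proof (intro ballI impI)
          fix e assume e: "e \<in> ?E" "realizes U e (\<pi> \<union> q)"
          have "sat U e (inst ?Z c \<zeta>)"
            using w(4) e unfolding implies_in_def realizes_def by blast
          moreover have "R (ys ! i) e = t ! i" if i: "i < length t" for i
          proof -
            have "ys ! i \<in> ?I" using i w(2,3) by auto
            then have "sat U e (lit (ys ! i))" using e(2) unfolding realizes_def q_def by blast
            then show ?thesis using w(5)[OF i] unfolding sat_lit by simp
          qed
          ultimately show "realizes U e {inst (pvars X \<zeta>') a \<zeta>'}" unfolding realizes_def using a(2) by simp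
        qed
        have "restr_params A\<^sub>0 (\<pi> \<union> q) \<subseteq> restr_params A' (\<pi> \<union> q)"
          using A'(1) unfolding restr_params_def by blast
        then show "implies_in L U X {inst (pvars X \<zeta>') a \<zeta>'} (restr_params A\<^sub>0 (\<pi> \<union> q))"
          using imp a(2) unfolding implies_in_def realizes_def by blast
      qed
    qed
    then show ?thesis using \<zeta>' unfolding t_compressible_def compressible_within_def by blast
  qed
  moreover have "\<forall>\<psi>\<in>q. \<exists>a\<in>?I. \<psi> = inst ?V a \<phi> \<or> \<psi> = Neg (inst ?V a \<phi>)"
    unfolding q_def lit_def by auto
  moreover have "\<forall>a\<in>?I. inst ?V a \<phi> \<in> q \<or> Neg (inst ?V a \<phi>) \<in> q"
  proof
    fix a assume "a \<in> ?I"
    then have "lit a \<in> q" unfolding q_def by blast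
    then show "inst ?V a \<phi> \<in> q \<or> Neg (inst ?V a \<phi>) \<in> q" unfolding lit_def by (auto split: if_splits)
  qed
  ultimately show ?thesis by blast
qed

section \<open>Density of compressible types\<close>

lemma consistent_UN:
  assumes "\<And>n. consistent L U X (P n)" "\<And>n :: nat. P n \<subseteq> P (Suc n)"
  shows "consistent L U X (\<Union>n. P n)"
  unfolding consistent_def
proof (intro allI impI)
  fix \<Gamma> assume \<Gamma>: "\<Gamma> \<subseteq> (\<Union>n. P n)" "finite \<Gamma>"
  have mono: "m \<le> n \<Longrightarrow> P m \<subseteq> P n" for m n using assms(2) by (rule lift_Suc_mono_le)
  have "\<exists>n. \<Gamma> \<subseteq> P n" using \<Gamma>(2,1)
  proof (induction \<Gamma>)
    case (insert \<gamma> \<Gamma>)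
    then obtain m n where "\<Gamma> \<subseteq> P m" "\<gamma> \<in> P n" by auto
    then show ?case using mono[of m "max m n"] mono[of n "max m n"] by (intro exI[of _ "max m n"]) auto
  qed simp
  then show "\<exists>e\<in>tup (universe L U) X. realizes U e \<Gamma>"
    using assms(1) \<Gamma>(2) unfolding consistent_def by blast
qed

text \<open>\<open>p\<close> is the type over \<open>A\<close> of a realisation of all stages. Its
  restriction to the formulas treated so far is contained in the current stage and, thanks to the
  instances of \<zeta>, implies it; t-compressibility passes along this equivalence.\<close>

lemma strongly_compressible_extension:
  fixes L :: "('s, 'f, 'r) lang" and U :: "('s, 'f, 'r, 'u) fo_struct"
  assumes "countable_lang L" "saturated L U" "uncountable (universe L U)" "NIP L U"
    and A: "A \<subseteq> universe L U" "A \<prec> universe L U" and X: "var_tuple L X"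
    and \<pi>: "partial_type L U A X \<pi>" "t_compressible L U A X \<pi>"
  shows "\<exists>p\<in>type_space L U A X. strongly_compressible L U A X p \<and> \<pi> \<subseteq> p"
proof -
  let ?E = "tup (universe L U) X"
  obtain \<zeta> where \<zeta>: "lfm L \<zeta>" "compresses L U A X \<zeta> \<pi> \<pi>"
    using \<pi>(2) unfolding t_compressible_def compressible_within_def by blast
  have "{\<phi> :: ('s, 'f, 'r, 'u) fm. lfm L \<phi>} \<noteq> {}" using \<zeta>(1) by blast
  then obtain enum :: "nat \<Rightarrow> ('s, 'f, 'r, 'u) fm" where enum: "{\<phi>. lfm L \<phi>} = range enum"
    using uncountable_def countable_lfm[OF assms(1)] by metis
  \<comment> \<open>Index \<open>0\<close> is reserved for \<zeta>, so that \<zeta> lies in every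
    \<open>?\<Delta>\<close> below.\<close>
  define \<phi> where "\<phi> n = (case n of 0 \<Rightarrow> \<zeta> | Suc m \<Rightarrow> enum m)" for n
  have \<phi>0: "\<phi> 0 = \<zeta>" unfolding \<phi>_def by simp
  have lfm: "lfm L (\<phi> n)" for n using \<zeta>(1) enum unfolding \<phi>_def by (auto split: nat.split)
  let ?ins = "\<lambda>n a. inst (pvars X (\<phi> n)) a (\<phi> n)" and ?I = "\<lambda>n. tup A (pvars X (\<phi> n))"
  define good where "good n q \<longleftrightarrow> (\<forall>\<psi>\<in>q. \<exists>a\<in>?I n. \<psi> = ?ins n a \<or> \<psi> = Neg (?ins n a)) \<and>
    (\<forall>a\<in>?I n. ?ins n a \<in> q \<or> Neg (?ins n a) \<in> q)" for n q
  define T where "T = {\<pi>. partial_type L U A X \<pi> \<and> t_compressible L U A X \<pi>}"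
  have ext: "\<exists>q. good n q \<and> \<pi>' \<union> q \<in> T" if "\<pi>' \<in> T" for \<pi>' n
    using t_compressible_extend[OF assms(4) A(1) X _ _ lfm[of n], of \<pi>'] that
    unfolding good_def T_def by blast
  have "\<exists>f. \<forall>n. f n \<in> T \<and> (n = 0 \<longrightarrow> f n = \<pi>) \<and> (\<exists>q. good n q \<and> f (Suc n) = f n \<union> q)"
  proof (rule dependent_nat_choice[where P = "\<lambda>n f. f \<in> T \<and> (n = 0 \<longrightarrow> f = \<pi>)" and
        Q = "\<lambda>n f g. \<exists>q. good n q \<and> g = f \<union> q", unfolded conj_assoc])
    show "\<exists>x. x \<in> T \<and> (0 = 0 \<longrightarrow> x = \<pi>)" using \<pi> unfolding T_def by blast
    show "\<exists>y. y \<in> T \<and> (Suc n = 0 \<longrightarrow> y = \<pi>) \<and> (\<exists>q. good n q \<and> y = x \<union> q)"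
      if "x \<in> T \<and> (n = 0 \<longrightarrow> x = \<pi>)" for x n
      using ext[of x n] that by blast
  qed
  then obtain P where P: "\<And>n. P n \<in> T" "P 0 = \<pi>" and "\<And>n. \<exists>q. good n q \<and> P (Suc n) = P n \<union> q"
    by blast
  then obtain q where q: "\<And>n. good n (q n)" "\<And>n. P (Suc n) = P n \<union> q n" by metis
  have PT: "partial_type L U A X (P n)" "t_compressible L U A X (P n)" for n
    using P(1) unfolding T_def by auto
  have PS: "P n = \<pi> \<union> (\<Union>m<n. q m)" for n
    by (induction n) (auto simp: P(2) q(2) lessThan_Suc)
  have "\<exists>e\<in>?E. realizes U e (\<Union>n. P n)"
  proof (rule saturated_realizes)
    show "infinite (universe L U)" using assms(3) countable_finite by blast
    show "X \<subseteq> UNIV \<times> sorts L" "countable X" using X unfolding var_tuple_def by auto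
    show "(\<Union>n. P n) \<subseteq> fms L A X" using PT(1) unfolding partial_type_def by blast
    show "consistent L U X (\<Union>n. P n)"
      by (rule consistent_UN) (use PT(1) q(2) in \<open>auto simp: partial_type_def\<close>)
  qed fact+
  then obtain e where e: "e \<in> ?E" "\<And>\<psi> n. \<psi> \<in> P n \<Longrightarrow> sat U e \<psi>" unfolding realizes_def by blast
  define p where "p = {\<psi>\<in>fms L A X. sat U e \<psi>}"
  have Pp: "P n \<subseteq> p" for n
    using PT(1)[of n] e(2) unfolding p_def partial_type_def by blast
  have "p \<in> type_space L U A X"
    unfolding type_space_def partial_type_def consistent_def mem_Collect_eq
  proof (intro conjI allI impI ballI)
    show "\<exists>e\<in>?E. realizes U e \<Gamma>" if "\<Gamma> \<subseteq> p" for \<Gamma>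
      using e(1) that unfolding p_def realizes_def by blast
    show "\<psi> \<in> p \<or> Neg \<psi> \<in> p" if "\<psi> \<in> fms L A X" for \<psi>
      using that unfolding p_def fms_def by auto
  qed (auto simp: p_def)
  moreover have "strongly_compressible L U A X p"
    unfolding strongly_compressible_def
  proof (intro allI impI)
    fix \<chi> :: "('s, 'f, 'r, 'u) fm" assume "lfm L \<chi>"
    then obtain m where m: "\<chi> = \<phi> (Suc m)" using enum unfolding \<phi>_def by auto
    \<comment> \<open>\<chi> has index \<open>Suc m\<close>, and its instances are decided by
      \<open>q (Suc m)\<close>, which enters at the next stage.\<close>
    let ?n = "Suc (Suc m)"
    let ?\<Delta> = "\<phi> ` {..<?n}"
    let ?r = "restr_fms A X p ?\<Delta>"
    have qr: "q i \<subseteq> ?r" if "i < ?n" for i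
    proof
      fix \<psi> assume \<psi>: "\<psi> \<in> q i"
      then have "\<psi> \<in> p" using Pp[of "Suc i"] q(2) by blast
      moreover have "\<exists>a\<in>?I i. \<psi> = ?ins i a \<or> \<psi> = Neg (?ins i a)"
        using q(1)[of i] \<psi> unfolding good_def by blast
      ultimately show "\<psi> \<in> ?r" using that unfolding restr_fms_def by blast
    qed
    \<comment> \<open>\<open>q i\<close> contains an instance or its negation, and \<open>e\<close>
      satisfies \<open>q i\<close>; the literal that \<open>e\<close> satisfies is therefore the one
      in \<open>q i\<close>.\<close>
    have rq: "?r \<subseteq> (\<Union>i<?n. q i)"
    proof
      fix \<psi> assume "\<psi> \<in> ?r"
      then obtain i a where i: "i < ?n" "a \<in> ?I i" "\<psi> = ?ins i a \<or> \<psi> = Neg (?ins i a)"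
        and sat: "sat U e \<psi>" unfolding restr_fms_def p_def by blast
      have "?ins i a \<in> q i \<or> Neg (?ins i a) \<in> q i" using q(1)[of i] i(2) unfolding good_def by blast
      moreover have "sat U e \<theta>" if "\<theta> \<in> q i" for \<theta> using e(2)[of \<theta> "Suc i"] q(2) that by blast
      ultimately have "\<psi> \<in> q i" using i(3) sat by fastforce
      then show "\<psi> \<in> (\<Union>i<?n. q i)" using i(1) by blast
    qed
    have rP: "?r \<subseteq> P ?n" using rq unfolding PS by blast
    \<comment> \<open>Formulas of \<pi> need not be instances of members of
      \<open>?\<Delta>\<close>. Each follows from an instance of \<zeta> that \<pi> implies;
      \<open>e\<close> satisfies it, so \<open>q 0\<close> contains it and not its negation.\<close>
    have r\<pi>: "sat U e' \<psi>" if e': "e' \<in> ?E" "realizes U e' ?r" and \<psi>: "\<psi> \<in> \<pi>" for e' \<psi>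
    proof -
      have "params \<psi> \<subseteq> A" using \<psi> \<pi>(1) unfolding partial_type_def fms_def by blast
      then obtain a where a: "a \<in> ?I 0" "implies_in L U X \<pi> {?ins 0 a}"
        "implies_in L U X {?ins 0 a} (restr_params (params \<psi>) \<pi>)"
        using \<zeta>(2) finite_params[of \<psi>] unfolding compresses_def \<phi>0 by blast
      have "sat U e (?ins 0 a)"
        using a(2) e(1) e(2)[of _ 0] unfolding implies_in_def realizes_def P(2) by blast
      moreover have "?ins 0 a \<in> q 0 \<or> Neg (?ins 0 a) \<in> q 0"
        using q(1)[of 0] a(1) unfolding good_def by blast
      moreover have "sat U e \<theta>" if "\<theta> \<in> q 0" for \<theta> using e(2)[of \<theta> "Suc 0"] q(2) that by blast
      ultimately have "?ins 0 a \<in> ?r" using qr[of 0] by fastforce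
      then have "realizes U e' (restr_params (params \<psi>) \<pi>)"
        using a(3) e' unfolding implies_in_def realizes_def by blast
      then show ?thesis using \<psi> unfolding realizes_def restr_params_def by blast
    qed
    have "realizes U e' (P ?n)" if "e' \<in> ?E" "realizes U e' ?r" for e'
      unfolding realizes_def
    proof
      fix \<psi> assume "\<psi> \<in> P ?n"
      then consider "\<psi> \<in> \<pi>" | i where "i < ?n" "\<psi> \<in> q i" unfolding PS by blast
      then show "sat U e' \<psi>"
      proof cases
        case 1
        then show ?thesis using r\<pi> that by blast
      next
        case 2
        then show ?thesis using qr that unfolding realizes_def by blast
      qed
    qed
    then have eq: "implies_in L U X ?r \<Psi>" if "implies_in L U X (P ?n) \<Psi>" for \<Psi>
      using that unfolding implies_in_def by blast
    have sub: "implies_in L U X \<Gamma> (restr_params A\<^sub>0 ?r)"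
      if "implies_in L U X \<Gamma> (restr_params A\<^sub>0 (P ?n))" for \<Gamma> A\<^sub>0
      using that rP unfolding implies_in_def realizes_def restr_params_def by blast
    have "t_compressible L U A X ?r"
      using PT(2)[of ?n] eq sub
      unfolding t_compressible_def compressible_within_def compresses_def by meson
    moreover have "\<chi> \<in> ?\<Delta>" unfolding m by simp
    ultimately show "\<exists>\<Delta>. finite \<Delta> \<and> \<chi> \<in> \<Delta> \<and> (\<forall>\<delta>\<in>\<Delta>. lfm L \<delta>) \<and> t_compressible L U A X (restr_fms A X p \<Delta>)"
      using lfm by (intro exI[of _ ?\<Delta>]) auto
  qed
  ultimately show ?thesis using Pp[of 0] P(2) by blast
qed

text \<open>Compression survives shrinking the compressed type and enlarging the type within which
  it takes place.\<close>

lemma strongly_compressible_imp_compressible: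
  fixes p :: "('s, 'f, 'r, 'u) fm set"
  assumes "strongly_compressible L U A X p"
  shows "compressible L U A X p"
  unfolding compressible_def
proof (intro allI impI)
  fix \<phi> :: "('s, 'f, 'r, 'u) fm" assume "lfm L \<phi>"
  then obtain \<Delta> \<zeta> where \<Delta>: "\<phi> \<in> \<Delta>" and \<zeta>: "lfm L \<zeta>"
    "compresses L U A X \<zeta> (restr_fms A X p \<Delta>) (restr_fms A X p \<Delta>)"
    using assms unfolding strongly_compressible_def t_compressible_def compressible_within_def by blast
  have "restr_fms A X p \<Delta> \<subseteq> p" unfolding restr_fms_def by blast
  then have 1: "implies_in L U X p \<Psi>" if "implies_in L U X (restr_fms A X p \<Delta>) \<Psi>" for \<Psi>
    using that unfolding implies_in_def realizes_def by blast
  have "restr_fms A X p {\<phi>} \<subseteq> restr_fms A X p \<Delta>" using \<Delta> unfolding restr_fms_def by blast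
  then have 2: "implies_in L U X \<Gamma> (restr_params A\<^sub>0 (restr_fms A X p {\<phi>}))"
    if "implies_in L U X \<Gamma> (restr_params A\<^sub>0 (restr_fms A X p \<Delta>))" for \<Gamma> A\<^sub>0
    using that unfolding implies_in_def realizes_def restr_params_def by blast
  have "compresses L U A X \<zeta> (restr_fms A X p {\<phi>}) p"
    using \<zeta>(2) 1 2 unfolding compresses_def by meson
  then show "compressible_within L U A X (restr_fms A X p {\<phi>}) p"
    using \<zeta>(1) unfolding compressible_within_def by blast
qed

text \<open>Replacing the parameters of \<theta> by fresh variables gives an
  \<open>L\<close>-formula with an instance over \<open>A\<close> equivalent to \<theta>, and this
  one instance serves every \<open>A\<^sub>0\<close>.\<close>

lemma t_compressible_singleton:
  fixes \<theta> :: "('s, 'f, 'r, 'u) fm"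
  assumes X: "var_tuple L X" and \<theta>: "\<theta> \<in> fms L A X"
  shows "t_compressible L U A X {\<theta>}"
proof -
  have wf: "wf_fm L \<theta>" and par: "params \<theta> \<subseteq> A" and fvX: "fv \<theta> \<subseteq> X"
    using \<theta> unfolding fms_def by auto
  have "\<exists>\<kappa>. inj_on \<kappa> (params \<theta>) \<and> (\<forall>c\<in>params \<theta>. snd (\<kappa> c) = fst c \<and> \<kappa> c \<notin> X \<union> bv \<theta>)"
    by (rule fresh_variables[OF finite_params finite_bv params_sorts[OF wf] X])
  then obtain \<kappa> where inj: "inj_on \<kappa> (params \<theta>)"
    and \<kappa>: "\<And>c. c \<in> params \<theta> \<Longrightarrow> snd (\<kappa> c) = fst c \<and> \<kappa> c \<notin> X \<and> \<kappa> c \<notin> bv \<theta>" by blast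
  \<comment> \<open>Passing \<open>fv \<theta>\<close> as the set of protected variables leaves the
    free variables in place; only parameters are renamed.\<close>
  define \<zeta> where "\<zeta> = rename (fv \<theta>) undefined \<kappa> \<theta>"
  have "lfm L \<zeta>"
    unfolding lfm_def
  proof
    show "wf_fm L \<zeta>" unfolding \<zeta>_def by (rule wf_rename[OF wf]) (use \<kappa> in auto)
    show "params \<zeta> = {}" unfolding \<zeta>_def by (rule params_rename)
  qed
  have fv\<zeta>: "fv \<zeta> \<subseteq> fv \<theta> \<union> \<kappa> ` params \<theta>"
    using fv_rename[of "fv \<theta>" undefined \<kappa> \<theta>] unfolding \<zeta>_def by simp
  define a where "a = (\<lambda>v. snd (inv_into (params \<theta>) \<kappa> v))"
  have a: "a (\<kappa> c) = snd c" if "c \<in> params \<theta>" for c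
    unfolding a_def inv_into_f_f[OF inj that] ..
  let ?a = "restrict a (pvars X \<zeta>)"
  have "?a \<in> tup A (pvars X \<zeta>)"
  proof (rule tupI)
    fix v assume "v \<in> pvars X \<zeta>"
    then obtain c where c: "c \<in> params \<theta>" "v = \<kappa> c" using fv\<zeta> fvX unfolding pvars_def by blast
    have "(snd v, a v) = c" unfolding c(2) using \<kappa>[OF c(1)] a[OF c(1)] by (metis prod.collapse)
    then show "(snd v, a v) \<in> A" using c(1) par by blast
  qed
  moreover have sat: "sat U e (inst (pvars X \<zeta>) ?a \<zeta>) \<longleftrightarrow> sat U e \<theta>" for e
  proof -
    let ?e = "override_on e a (\<kappa> ` params \<theta>)"
    have "sat U e (inst (pvars X \<zeta>) ?a \<zeta>) \<longleftrightarrow> sat U ?e \<zeta>"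
      unfolding sat_inst
    proof (rule sat_cong)
      fix v assume v: "v \<in> fv \<zeta>"
      show "override_on e ?a (pvars X \<zeta>) v = ?e v"
      proof (cases "v \<in> X")
        case True
        then have "v \<notin> \<kappa> ` params \<theta>" using \<kappa> by blast
        then show ?thesis using True by (simp add: override_on_def pvars_def)
      next
        case False
        then have "v \<in> \<kappa> ` params \<theta>" "v \<in> pvars X \<zeta>" using v fv\<zeta> fvX unfolding pvars_def by blast+
        then show ?thesis by (simp add: override_on_def)
      qed
    qed
    also have "\<dots> \<longleftrightarrow> sat U (\<lambda>v. if v \<in> fv \<theta> then ?e v else ?e (undefined v)) \<theta>"
      unfolding \<zeta>_def
    proof (rule sat_rename)
      show "?e (\<kappa> c) = snd c \<and> \<kappa> c \<notin> bv \<theta>" if "c \<in> params \<theta>" for c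
        using \<kappa>[OF that] a[OF that] that by (simp add: override_on_def)
    qed simp
    also have "\<dots> \<longleftrightarrow> sat U e \<theta>"
    proof (rule sat_cong)
      fix v assume v: "v \<in> fv \<theta>"
      then have "v \<notin> \<kappa> ` params \<theta>" using \<kappa> fvX by blast
      then show "(if v \<in> fv \<theta> then ?e v else ?e (undefined v)) = e v"
        using v by (simp add: override_on_def)
    qed
    finally show ?thesis .
  qed
  ultimately have "compresses L U A X \<zeta> {\<theta>} {\<theta>}"
    unfolding compresses_def implies_in_def realizes_def restr_params_def by auto
  then show ?thesis
    using \<open>lfm L \<zeta>\<close> unfolding t_compressible_def compressible_within_def by blast
qed

theorem corollary3p21:
  fixes L :: "('s, 'f, 'r) lang"
    and T :: "('s, 'f, 'r, 'u) fm set"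
    and U :: "('s, 'f, 'r, 'u) fo_struct"
    and A :: "('s \<times> 'u) set"
    and X :: "'s var set"
  assumes "wf_lang L" and "countable_lang L"
    and "complete_theory L T"
    and "monster_model L T U"
    and "NIP L U"
    and "A \<subseteq> universe L U" and "A \<prec> universe L U"
    and "var_tuple L X"
  shows "(\<forall>\<theta>\<in>fms L A X. consistent L U X {\<theta>} \<longrightarrow>
            (\<exists>p\<in>type_space L U A X. compressible L U A X p \<and> implies_in L U X p {\<theta>})) \<and>
         (\<forall>\<pi>. partial_type L U A X \<pi> \<and> t_compressible L U A X \<pi> \<longrightarrow>
            (\<exists>p\<in>type_space L U A X. strongly_compressible L U A X p \<and> \<pi> \<subseteq> p))"
proof -
  have "saturated L U" "uncountable (universe L U)"
    using assms(4) unfolding monster_model_def by auto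
  note ext = strongly_compressible_extension[OF assms(2) this assms(5-8)]
  \<comment> \<open>Density is the case where \<pi> consists of \<theta> alone.\<close>
  have "\<exists>p\<in>type_space L U A X. compressible L U A X p \<and> implies_in L U X p {\<theta>}"
    if \<theta>: "\<theta> \<in> fms L A X" "consistent L U X {\<theta>}" for \<theta>
  proof -
    have "partial_type L U A X {\<theta>}" using \<theta> unfolding partial_type_def by blast
    from ext[OF this t_compressible_singleton[OF assms(8) \<theta>(1)]]
    obtain p where "p \<in> type_space L U A X" "strongly_compressible L U A X p" "\<theta> \<in> p" by blast
    moreover from \<open>\<theta> \<in> p\<close> have "implies_in L U X p {\<theta>}" unfolding implies_in_def realizes_def by blast
    ultimately show ?thesis using strongly_compressible_imp_compressible by blast
  qed
  then show ?thesis using ext by blast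
qed

end
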